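(* Let $\Phi:\mathcal{H}_2(\mathbb{C})\to\mathcal{H}_2(\mathbb{C})$ be a map. Then $\Phi(ABA)=\Phi(A)\Phi(B)\Phi(A)$ for all $A,B\in\mathcal{H}_2(\mathbb{C})$ if and only if there exists a unitary matrix $U\in\mathcal{M}_2(\mathbb{C})$ such that $\Phi$ has one of the following forms: (i) $\Phi(A)=U\begin{bmatrix}\varphi_1(A)&0\\0&\varphi_2(A)\end{bmatrix}U^*$ for all $A$, where $\varphi_1,\varphi_2:\mathcal{H}_2(\mathbb{C})\to\mathbb{R}$ are J.T.P. homomorphisms having the form $\varphi_i(A)=\psi_i(|\det A|)\,\eta_i(\mathrm{Syl}(A))$ for $i=1,2$, with $\psi_1,\psi_2:[0,\infty)\to\mathbb{C}$ multiplicative functions and $\eta_1,\eta_2:\{0,1,2\}\to\{-1,1\}$ arbitrary mappings; (ii) $\Phi(A)=\pm UAU^*$ for all $A$ (with a fixed sign); (iii) $\Phi(A)=\pm U\bar{A}U^*=\pm UA^TU^*$ for all $A$ (with a fixed sign); (iv) $\Phi(A)=\begin{cases}\pm\beta(\det A)\cdot U\widetilde{\Phi}(A)U^*;&\operatorname{rank}A=2\\0;&\operatorname{rank}A\le 1\end{cases}$ (with a fixed sign), where $\beta:\mathbb{R}^*\to\mathbb{R}^*$ is a unital multiplicative map and $\widetilde{\Phi}$ is given on invertible $A\in\mathcal{H}_2(\mathbb{C})$ by one of the eight formulas $$\widetilde\Phi(A)=A,\quad \bar{A},\quad A^{-1},\quad \bar{A}^{-1},\quad \eta(A)A,\quad \eta(A)\bar{A},\quad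 \eta(A)A^{-1},\quad \eta(A)\bar{A}^{-1},$$ with $\eta(A)=1$ if $A$ is positive definite or invertible and nondefinite, and $\eta(A)=-1$ if $A$ is negative definite.
   Context: $\mathcal{M}_2(\mathbb{C})$ is the set of complex $2\times2$ matrices; $\mathcal{H}_2(\mathbb{C})=\{A\in\mathcal{M}_2(\mathbb{C}):A=A^*\}$ is the set of Hermitian ones. A map $\Phi$ between two sets of square matrices (real or complex numbers being $1\times1$ matrices) is a J.T.P. (Jordan triple product) homomorphism if $\Phi(ABA)=\Phi(A)\Phi(B)\Phi(A)$ for all $A,B$ in its domain. $\mathrm{Syl}(A)$ denotes the number of positive eigenvalues of $A$, counted with multiplicity. $\bar{A}$ is the entrywise complex conjugate. $\mathbb{R}^*=\mathbb{R}\setminus\{0\}$. A function $\psi$ is multiplicative if $\psi(xy)=\psi(x)\psi(y)$ for all $x,y$, and unital if $\psi(1)=1$. "Invertible nondefinite" means having one positive and one negative eigenvalue. *)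

theory Defs
  imports "HOL-Analysis.Analysis" "HOL-Computational_Algebra.Polynomial"
begin

definition conj_matrix :: "complex^'n^'m \<Rightarrow> complex^'n^'m" where
  "conj_matrix A = map_matrix cnj A"

definition conj_transpose :: "complex^'n^'m \<Rightarrow> complex^'m^'n" where
  "conj_transpose A = transpose (conj_matrix A)"

definition unitary_matrix :: "complex^'n^'n \<Rightarrow> bool" where
  "unitary_matrix U \<longleftrightarrow> U ** conj_transpose U = mat 1 \<and> conj_transpose U ** U = mat 1"

definition H2 :: "(complex^2^2) set" where
  "H2 = {A. conj_transpose A = A}"

definition diag2 :: "complex \<Rightarrow> complex \<Rightarrow> complex^2^2" where
  "diag2 a b = vector [vector [a, 0], vector [0, b]]"

definition charpoly :: "'a::comm_ring_1^'n^'n \<Rightarrow> 'a poly" where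
  "charpoly A = det (mat [:0, 1:] - map_matrix (\<lambda>a. [:a:]) A)"

text \<open>The multiset of eigenvalues, each with its algebraic multiplicity.\<close>

definition eigenvalues :: "complex^'n^'n \<Rightarrow> complex multiset" where
  "eigenvalues A = proots (charpoly A)"

lemma poly_charpoly: "poly (charpoly A) c = det (mat c - A)"
  for A :: "'a::comm_ring_1^'n^'n"
proof -
  have *: "poly ((mat [:0, 1:] - map_matrix (\<lambda>a. [:a:]) A) $ i $ j) c = (mat c - A) $ i $ j" for i j
    by (simp add: mat_def)
  have sg: "poly (of_int k) c = (of_int k :: 'a)" for k
    by (simp add: of_int_poly)
  show ?thesis
    unfolding charpoly_def det_def poly_sum poly_mult poly_prod * sg ..
qed

lemma eigenvalues_iff:
  fixes A :: "complex^2^2"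
  shows "c \<in># eigenvalues A \<longleftrightarrow> (\<exists>v. v \<noteq> 0 \<and> A *v v = c *s v)"
proof -
  have "charpoly A \<noteq> 0"
  proof -
    have "coeff (charpoly A) 2 = 1"
      by (simp add: charpoly_def det_2 mat_def numeral_2_eq_2)
    then show ?thesis by auto
  qed
  then have "c \<in># eigenvalues A \<longleftrightarrow> det (mat c - A) = 0"
    by (simp add: eigenvalues_def poly_charpoly)
  also have "\<dots> \<longleftrightarrow> \<not> invertible (mat c - A)"
    by (simp add: invertible_det_nz)
  also have "\<dots> \<longleftrightarrow> (\<exists>v. v \<noteq> 0 \<and> (mat c - A) *v v = 0)"
    by (metis invertible_left_inverse matrix_left_invertible_ker)
  also have "\<dots> \<longleftrightarrow> (\<exists>v. v \<noteq> 0 \<and> A *v v = c *s v)"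
  proof -
    have "(mat c - A) *v v = c *s v - A *v v" for v
      by (simp add: vec_eq_iff matrix_vector_mult_def sum_2 forall_2 mat_def algebra_simps)
    then show ?thesis by auto
  qed
  finally show ?thesis .
qed

definition Syl :: "complex^'n^'n \<Rightarrow> nat" where
  "Syl A = size {#c \<in># eigenvalues A. c \<in> \<real> \<and> 0 < Re c#}"

text \<open>On \<^typ>\<open>complex^'n\<close> the library inner product is the real part of the Hermitian one,
  and the form \<open>x\<^sup>* A x\<close> of a Hermitian matrix is real.\<close>

definition positive_definite :: "complex^2^2 \<Rightarrow> bool" where
  "positive_definite A \<longleftrightarrow> A \<in> H2 \<and> (\<forall>x. x \<noteq> 0 \<longrightarrow> x \<bullet> (A *v x) > 0)"

definition negative_definite :: "complex^2^2 \<Rightarrow> bool" where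
  "negative_definite A \<longleftrightarrow> A \<in> H2 \<and> (\<forall>x. x \<noteq> 0 \<longrightarrow> x \<bullet> (A *v x) < 0)"

definition invertible_nondefinite :: "complex^2^2 \<Rightarrow> bool" where
  "invertible_nondefinite A \<longleftrightarrow> A \<in> H2 \<and>
     (\<exists>a b::real. a > 0 \<and> b < 0 \<and> eigenvalues A = {#complex_of_real a, complex_of_real b#})"

text \<open>The cases below exhaust the invertible Hermitian matrices, the only ones at which
  this function is used.\<close>

definition eta :: "complex^2^2 \<Rightarrow> real" where
  "eta A = (if positive_definite A \<or> invertible_nondefinite A then 1
            else if negative_definite A then - 1 else undefined)"

definition multiplicative_on :: "'a::times set \<Rightarrow> ('a \<Rightarrow> 'b::times) \<Rightarrow> bool" where
  "multiplicative_on S f \<longleftrightarrow> (\<forall>x\<in>S. \<forall>y\<in>S. f (x * y) = f x * f y)"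

definition jtp_hom :: "(complex^2^2 \<Rightarrow> complex^2^2) \<Rightarrow> bool" where
  "jtp_hom F \<longleftrightarrow> (\<forall>A\<in>H2. \<forall>B\<in>H2. F (A ** B ** A) = F A ** F B ** F A)"

definition jtp_hom_real :: "(complex^2^2 \<Rightarrow> real) \<Rightarrow> bool" where
  "jtp_hom_real f \<longleftrightarrow> (\<forall>A\<in>H2. \<forall>B\<in>H2. f (A ** B ** A) = f A * f B * f A)"

text \<open>The determinant of a Hermitian matrix is real, so \<^term>\<open>norm (det A)\<close> is its absolute
  value (as a real number); the range of \<open>\<psi>\<close> is complex.\<close>

definition det_Syl_form :: "(complex^2^2 \<Rightarrow> real) \<Rightarrow> bool" where
  "det_Syl_form f \<longleftrightarrow>
     (\<exists>(\<psi> :: real \<Rightarrow> complex) (\<eta> :: nat \<Rightarrow> real).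
        multiplicative_on {0..} \<psi> \<and> \<eta> \<in> {0, 1, 2} \<rightarrow> {- 1, 1} \<and>
        (\<forall>A\<in>H2. complex_of_real (f A) = \<psi> (norm (det A)) * complex_of_real (\<eta> (Syl A))))"

definition basic_maps :: "(complex^2^2 \<Rightarrow> complex^2^2) set" where
  "basic_maps =
     {\<lambda>A. A,
      \<lambda>A. conj_matrix A,
      \<lambda>A. matrix_inv A,
      \<lambda>A. matrix_inv (conj_matrix A),
      \<lambda>A. eta A *\<^sub>R A,
      \<lambda>A. eta A *\<^sub>R conj_matrix A,
      \<lambda>A. eta A *\<^sub>R matrix_inv A,
      \<lambda>A. eta A *\<^sub>R matrix_inv (conj_matrix A)}"

end

theory Submission
  imports Defs
begin

text \<open>
  Writing Hermitian matrices as \<open>a + u\<cdot>\<sigma>\<close> in terms of the Pauli matrices turns \<open>ABA\<close> into a triple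
  product on \<open>\<real> \<times> \<real>\<^sup>3\<close> (a spin factor), with determinant \<open>a\<^sup>2 - |u|\<^sup>2\<close>. Up to sign we may assume
  \<open>\<Phi>(I) = I\<close>, since a value \<open>\<Phi>(I) \<noteq> \<plusminus>I\<close> forces all values to be diagonal in one basis.
  Conjugation by a reflection \<open>u\<cdot>\<sigma>\<close>, \<open>|u| = 1\<close>, is the half-turn about \<open>u\<close>, and half-turns act transitively
  on the sphere; so \<open>\<Phi>\<close> sends either all reflections to one scalar or all to reflections. In the
  scalar case \<open>\<Phi>(A)\<close> depends only on \<open>|det A|\<close> and the signs of the eigenvalues, and the values commute. In
  the other case \<open>\<Phi>\<close> acts on the sphere through a function \<open>h\<close> of inner products: it is constant (and
  the values commute again) or odd, and then \<open>h(\<surd>t)\<^sup>2\<close> is additive, so \<open>h\<close> is the identity and the action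
  is an isometry. After composing with its inverse, \<open>\<Phi>\<close> preserves spectral projections and is described by a
  multiplicative function of the eigenvalue pair, which the relation \<open>\<Phi>(SRS) = \<Phi>(S) R \<Phi>(S)\<close> determines.
  Finally an isometry of \<open>\<real>\<^sup>3\<close> is a product of half-turns, possibly followed by a coordinate flip, i.e.
  a unitary conjugation, possibly composed with complex conjugation.
\<close>

subsection \<open>The spin factor and its half-turns\<close>

type_synonym spin = "real \<times> (real^3)"

text \<open>This is ABA for A = a + u.sigma and B = b + v.sigma, using (u.sigma)(v.sigma)(u.sigma) =
  2(u.v) u.sigma - |u|^2 v.sigma; the cross products in the other terms cancel.\<close>

definition tri :: "spin \<Rightarrow> spin \<Rightarrow> spin" where
  "tri A B = ((fst A)\<^sup>2 * fst B + 2 * fst A * (snd A \<bullet> snd B) + (snd A \<bullet> snd A) * fst B,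
     (2 * (fst A * fst B + snd A \<bullet> snd B)) *\<^sub>R snd A + ((fst A)\<^sup>2 - snd A \<bullet> snd A) *\<^sub>R snd B)"

definition tri_hom :: "(spin \<Rightarrow> spin) \<Rightarrow> bool" where
  "tri_hom F \<longleftrightarrow> (\<forall>A B. F (tri A B) = tri (F A) (F B))"

definition qdet :: "spin \<Rightarrow> real" where
  "qdet A = (fst A)\<^sup>2 - snd A \<bullet> snd A"

definition halfturn :: "real^3 \<Rightarrow> real^3 \<Rightarrow> real^3" where
  "halfturn r v = (2 * (r \<bullet> v)) *\<^sub>R r - v"

text \<open>For a unit vector \<open>u\<close> the spectral form l P + m (1 - P) with the rank-one
  projection P = (1 + u.sigma)/2.\<close>

definition spec :: "real^3 \<Rightarrow> real \<Rightarrow> real \<Rightarrow> spin" where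
  "spec u l m = ((l + m) / 2, ((l - m) / 2) *\<^sub>R u)"

text \<open>In terms of matrices, all values are diagonal in one orthonormal basis; this is the
  source of form (i).\<close>

definition axial :: "(spin \<Rightarrow> spin) \<Rightarrow> bool" where
  "axial F \<longleftrightarrow> (\<exists>n. norm n = 1 \<and> (\<forall>A. \<exists>d. snd (F A) = d *\<^sub>R n))"

lemma tri_homD: "tri_hom F \<Longrightarrow> F (tri A B) = tri (F A) (F B)"
  unfolding tri_hom_def by blast

lemma tri_one_left [simp]: "tri (1, 0) B = B"
  by (simp add: tri_def prod_eq_iff)

lemma tri_minus_one_left [simp]: "tri (- 1, 0) B = B"
  by (simp add: tri_def prod_eq_iff)

lemma tri_scalar_left: "tri (s, 0) B = s\<^sup>2 *\<^sub>R B"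
  by (simp add: tri_def prod_eq_iff)

lemma tri_zero_left [simp]: "tri 0 B = 0"
  by (simp add: tri_def prod_eq_iff)

lemma tri_zero_right [simp]: "tri A 0 = 0"
  by (simp add: tri_def prod_eq_iff)

lemma tri_unit_left: "norm r = 1 \<Longrightarrow> tri (0, r) (b, v) = (b, halfturn r v)"
  by (simp add: tri_def halfturn_def norm_eq_1)

lemma tri_scaleR_right: "tri A (c *\<^sub>R B) = c *\<^sub>R tri A B"
  by (simp add: tri_def prod_eq_iff algebra_simps)

lemma tri_scaleR_left: "tri (c *\<^sub>R A) B = c\<^sup>2 *\<^sub>R tri A B"
  by (simp add: tri_def prod_eq_iff algebra_simps power2_eq_square)

lemma tri_one_right: "tri A (1, 0) = ((fst A)\<^sup>2 + snd A \<bullet> snd A, (2 * fst A) *\<^sub>R snd A)"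
  by (simp add: tri_def)

lemma tri_scalar_right: "tri A (c, 0) = c *\<^sub>R tri A (1, 0)"
  using tri_scaleR_right[of A c "(1, 0)"] by simp

lemma tri_self: "tri A A = (fst A * ((fst A)\<^sup>2 + 3 * (snd A \<bullet> snd A)),
    (3 * (fst A)\<^sup>2 + snd A \<bullet> snd A) *\<^sub>R snd A)"
  by (simp add: tri_def algebra_simps power2_eq_square flip: scaleR_add_left scaleR_diff_left)

lemma tri_self_eq_0: "tri A A = 0 \<Longrightarrow> A = 0"
proof -
  assume *: "tri A A = 0"
  then have 1: "fst A * ((fst A)\<^sup>2 + 3 * (snd A \<bullet> snd A)) = 0"
    and 2: "(3 * (fst A)\<^sup>2 + snd A \<bullet> snd A) *\<^sub>R snd A = 0"
    by (auto simp: tri_self prod_eq_iff)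
  have "fst A = 0"
    using 1 by (auto simp: add_nonneg_eq_0_iff)
  with 2 have "snd A = 0" by auto
  with \<open>fst A = 0\<close> show "A = 0" by (simp add: prod_eq_iff)
qed

text \<open>Both sides are the fourth power of \<open>A\<close>.\<close>

lemma tri_square: "tri A (tri A (1, 0)) = tri (tri A (1, 0)) (1, 0)"
  by (simp add: tri_def algebra_simps power2_eq_square flip: scaleR_add_left scaleR_diff_left)

lemma qdet_tri: "qdet (tri A B) = (qdet A)\<^sup>2 * qdet B"
  by (simp add: qdet_def tri_def inner_simps inner_commute power2_eq_square algebra_simps)

lemma tri_spec:
  assumes "norm u = 1"
  shows "tri (spec u l m) (spec u l' m') = spec u (l\<^sup>2 * l') (m\<^sup>2 * m')"
proof -
  have "u \<bullet> u = 1" using assms by (simp add: norm_eq_1)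
  then show ?thesis
    by (simp add: tri_def spec_def field_simps power2_eq_square flip: scaleR_add_left scaleR_diff_left)
qed

lemma spec_minus: "spec (- u) l m = spec u m l"
  unfolding spec_def scaleR_minus_right scaleR_minus_left[symmetric] minus_divide_left by (simp add: add.commute)

lemma spec_one: "spec u l l = (l, 0)"
  by (simp add: spec_def)

lemma qdet_spec: "norm u = 1 \<Longrightarrow> qdet (spec u l m) = l * m"
  by (simp add: qdet_def spec_def norm_eq_1 power2_eq_square field_simps)

lemma ex_unit: "\<exists>u :: real^3. norm u = 1"
  by (rule exI[of _ "axis 1 1"]) simp

lemma spec_cases:
  obtains u where "norm u = 1" "A = spec u (fst A + norm (snd A)) (fst A - norm (snd A))"
proof (cases "snd A = 0")
  case True
  obtain u :: "real^3" where "norm u = 1" using ex_unit by blast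
  then show ?thesis using that True by (auto simp: spec_def prod_eq_iff)
next
  case False
  then show ?thesis using that[of "snd A /\<^sub>R norm (snd A)"] by (auto simp: spec_def prod_eq_iff)
qed

lemma ex_unit_orthogonal: "\<exists>w :: real^3. norm w = 1 \<and> w \<bullet> u = 0 \<and> w \<bullet> v = 0"
proof -
  have "dim {u, v} < DIM(real^3)"
    using dim_le_card'[of "{u, v}"] by (simp add: card_insert_if split: if_splits)
  then obtain x where "x \<noteq> 0" "\<And>y. y \<in> span {u, v} \<Longrightarrow> orthogonal x y"
    using orthogonal_to_subspace_exists[of "{u, v}"] by blast
  then have "x \<bullet> u = 0" "x \<bullet> v = 0" by (auto simp: orthogonal_def span_base)
  then show ?thesis
    using \<open>x \<noteq> 0\<close> by (intro exI[of _ "x /\<^sub>R norm x"]) simp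
qed

section \<open>Transitivity of half-turns on the sphere and on pairs of unit vectors\<close>

lemma inner_halfturn:
  assumes "norm r = 1"
  shows "halfturn r u \<bullet> halfturn r v = u \<bullet> v"
  using assms
  by (simp add: halfturn_def norm_eq_1 inner_simps inner_commute algebra_simps)

lemma norm_halfturn: "norm r = 1 \<Longrightarrow> norm (halfturn r u) = norm u"
  by (simp add: norm_eq_sqrt_inner inner_halfturn)

lemma halfturn_self: "norm r = 1 \<Longrightarrow> halfturn r r = r"
  by (simp add: halfturn_def norm_eq_1 scaleR_2)

lemma halfturn_scaleR: "halfturn r (c *\<^sub>R v) = c *\<^sub>R halfturn r v"
  by (simp add: halfturn_def algebra_simps)

lemma halfturn_orthogonal: "r \<bullet> v = 0 \<Longrightarrow> halfturn r v = - v"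
  by (simp add: halfturn_def)

lemma halfturn_fixed: "halfturn r v = v \<Longrightarrow> v = (r \<bullet> v) *\<^sub>R r"
proof -
  assume "halfturn r v = v"
  then have "2 *\<^sub>R v = 2 *\<^sub>R ((r \<bullet> v) *\<^sub>R r)"
    by (simp add: halfturn_def algebra_simps scaleR_2)
  then show ?thesis by (metis scaleR_cancel_left zero_neq_numeral)
qed

lemma halfturn_fixed_unit:
  assumes "norm r = 1" "norm v = 1" "halfturn r v = v"
  shows "v = r \<or> v = - r"
proof -
  have *: "v = (r \<bullet> v) *\<^sub>R r" using assms(3) by (rule halfturn_fixed)
  have "norm v = \<bar>r \<bullet> v\<bar> * norm r" by (subst *) simp
  then have "r \<bullet> v = 1 \<or> r \<bullet> v = - 1" using assms by auto
  then show ?thesis using * by (metis scaleR_minus1_left scaleR_one)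
qed

text \<open>\<open>u + v\<close> bisects the angle between two vectors of equal length, so the
  half-turn about it exchanges them.\<close>

lemma halfturn_sum:
  assumes "norm u = norm v" "u + v \<noteq> 0" "r = (u + v) /\<^sub>R norm (u + v)"
  shows "halfturn r u = v" "norm r = 1"
proof -
  have eq: "2 * ((u + v) \<bullet> u) = (norm (u + v))\<^sup>2"
    using assms(1) by (simp add: power2_norm_eq_inner inner_simps inner_commute norm_eq)
  have "(2 * (r \<bullet> u)) *\<^sub>R r = ((2 * ((u + v) \<bullet> u)) / (norm (u + v))\<^sup>2) *\<^sub>R (u + v)"
    by (simp add: assms(3) power2_eq_square divide_simps)
  also have "\<dots> = u + v" unfolding eq using assms(2) by simp
  finally show "halfturn r u = v" by (simp add: halfturn_def)
  show "norm r = 1" using assms by simp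
qed

lemma halfturn_transitive:
  assumes "norm u = norm v"
  obtains r where "norm r = 1" "halfturn r u = v"
proof (cases "u + v = 0")
  case True
  obtain r where "norm r = 1" "r \<bullet> u = 0" using ex_unit_orthogonal by blast
  moreover from True have "v = - u" by (simp add: eq_neg_iff_add_eq_0 add.commute)
  ultimately show ?thesis using that[of r] by (simp add: halfturn_orthogonal)
next
  case False
  then show ?thesis using halfturn_sum[OF assms False refl] that by blast
qed

text \<open>The first half-turn brings \<open>u\<close> to \<open>u'\<close>. The second has an axis
  orthogonal to \<open>u'\<close> and yields \<open>- u'\<close>. The third axis is also orthogonal
  to \<open>u'\<close>, so it restores \<open>u'\<close> and is free to move the second vector to
  \<open>v'\<close>.\<close>

lemma halfturn_pair_transitive:
  assumes "norm u = 1" "norm v = 1" "norm u' = 1" "norm v' = 1" "u \<bullet> v = u' \<bullet> v'"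
  obtains r1 r2 r3 where "norm r1 = 1" "norm r2 = 1" "norm r3 = 1"
    "halfturn r3 (halfturn r2 (halfturn r1 u)) = u'"
    "halfturn r3 (halfturn r2 (halfturn r1 v)) = v'"
proof -
  obtain r1 where r1: "norm r1 = 1" "halfturn r1 u = u'"
    using halfturn_transitive[of u u'] assms by auto
  obtain r2 where r2: "norm r2 = 1" "r2 \<bullet> u' = 0" using ex_unit_orthogonal by blast
  define w where "w = halfturn r2 (halfturn r1 v)"
  have m: "halfturn r2 u' = - u'" using r2 by (simp add: halfturn_orthogonal)
  have "w \<bullet> (- u') = v \<bullet> u"
    using inner_halfturn[OF r2(1), of "halfturn r1 v" u'] inner_halfturn[OF r1(1), of v u] r1(2) m
    by (simp add: w_def)
  \<comment> \<open>So the bisector of \<open>w\<close> and \<open>v'\<close> is an admissible third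
    axis.\<close>
  then have w0: "(w + v') \<bullet> u' = 0" using assms(5) by (simp add: inner_simps inner_commute)
  have nw: "norm w = norm v'" using r1 r2 assms by (simp add: w_def norm_halfturn)
  obtain r3 where r3: "norm r3 = 1" "halfturn r3 w = v'" "r3 \<bullet> u' = 0"
  proof (cases "w + v' = 0")
    case True
    obtain r where "norm r = 1" "r \<bullet> u' = 0" "r \<bullet> w = 0" using ex_unit_orthogonal by blast
    moreover from True have "v' = - w" by (simp add: eq_neg_iff_add_eq_0 add.commute)
    ultimately show ?thesis using that[of r] by (simp add: halfturn_orthogonal)
  next
    case False
    note h = halfturn_sum[OF nw False refl]
    show ?thesis by (rule that[OF h(2) h(1)]) (simp add: w0)
  qed
  show ?thesis
    using that[OF r1(1) r2(1) r3(1)] r1 r3 m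
    by (simp add: w_def halfturn_orthogonal)
qed

subsection \<open>Homomorphisms with commuting values\<close>

lemma axialI: "w \<noteq> 0 \<Longrightarrow> (\<And>A. \<exists>d. snd (F A) = d *\<^sub>R w) \<Longrightarrow> axial F"
proof -
  assume w: "w \<noteq> 0" and *: "\<And>A. \<exists>d. snd (F A) = d *\<^sub>R w"
  have "\<exists>d. snd (F A) = d *\<^sub>R (w /\<^sub>R norm w)" for A
  proof -
    obtain d where "snd (F A) = d *\<^sub>R w" using * by blast
    then have "snd (F A) = (d * norm w) *\<^sub>R (w /\<^sub>R norm w)" using w by simp
    then show ?thesis by blast
  qed
  then show ?thesis unfolding axial_def using w by (intro exI[of _ "w /\<^sub>R norm w"]) auto
qed

lemma axial_pairwise:
  assumes "\<And>A B. snd (F A) \<noteq> 0 \<Longrightarrow> \<exists>d. snd (F B) = d *\<^sub>R snd (F A)"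
  shows "axial F"
proof (cases "\<exists>A. snd (F A) \<noteq> 0")
  case True
  then show ?thesis using assms axialI[of _ F] by blast
next
  case False
  then have "snd (F A) = 0" for A by blast
  moreover obtain u :: "real^3" where "norm u = 1" using ex_unit by blast
  ultimately show ?thesis unfolding axial_def by (metis scaleR_zero_left)
qed

text \<open>Such an \<open>E\<close> has eigenvalues in {-1, 0, 1}. With nonzero vector part they
  differ: 1 and -1 give determinant -1, and a zero eigenvalue gives determinant 0.\<close>

lemma tri_cube_eq_self:
  assumes E: "tri E E = E"
  shows "E = 0 \<or> E = (1, 0) \<or> E = (- 1, 0) \<or> (snd E \<noteq> 0 \<and> (fst E)\<^sup>2 - snd E \<bullet> snd E \<in> {- 1, 0})"
proof -
  define e w s where "e = fst E" and "w = snd E" and "s = w \<bullet> w"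
  have 1: "e * (e\<^sup>2 + 3 * s) = e" and "(3 * e\<^sup>2 + s) *\<^sub>R w = w"
    using E unfolding tri_self by (auto simp: prod_eq_iff e_def w_def s_def)
  then have 2: "w = 0 \<or> 3 * e\<^sup>2 + s = 1"
    by (metis scaleR_cancel_right scaleR_one)
  show ?thesis
  proof (cases "w = 0")
    case True
    then have "e * (e\<^sup>2 - 1) = 0" using 1 by (simp add: s_def algebra_simps)
    then have "e = 0 \<or> e = 1 \<or> e = - 1" by (auto simp: power2_eq_1_iff)
    with True show ?thesis by (auto simp: e_def w_def prod_eq_iff)
  next
    case False
    with 2 have 3: "3 * e\<^sup>2 + s = 1" by blast
    have "e = 0 \<or> e\<^sup>2 + 3 * s = 1" using 1 by simp
    then have "e\<^sup>2 - s \<in> {- 1, 0}" using 3 by auto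
    with False show ?thesis by (auto simp: e_def w_def s_def)
  qed
qed

text \<open>\<open>E = F (1, 0)\<close> satisfies EEE = E and E F(B) E = F(B). If its vector part w
  is nonzero, the vector part v of F(B) satisfies v = c w + (det E) v with det E in {-1, 0}, so it
  is a multiple of w.\<close>

lemma tri_hom_one:
  assumes "tri_hom F"
  shows "axial F \<or> F (1, 0) = (1, 0) \<or> F (1, 0) = (- 1, 0)"
proof -
  define E where "E = F (1, 0)"
  have EB: "F B = tri E (F B)" for B
    unfolding E_def using tri_homD[OF assms, of "(1, 0)" B] by simp
  have E: "tri E E = E" using EB[of "(1, 0)"] by (simp add: E_def)
  consider "E = 0" | "E = (1, 0) \<or> E = (- 1, 0)"
    | "snd E \<noteq> 0" "(fst E)\<^sup>2 - snd E \<bullet> snd E \<in> {- 1, 0}"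
    using tri_cube_eq_self[OF E] by blast
  then show ?thesis
  proof cases
    case 1
    then have "F B = 0" for B using EB[of B] by simp
    then show ?thesis using axial_pairwise[of F] by simp
  next
    case 2
    then show ?thesis by (auto simp: E_def)
  next
    case 3
    have "\<exists>d. snd (F B) = d *\<^sub>R snd E" for B
    proof -
      define v c where "v = snd (F B)" and "c = 2 * (fst E * fst (F B) + snd E \<bullet> v)"
      have "v = c *\<^sub>R snd E + ((fst E)\<^sup>2 - snd E \<bullet> snd E) *\<^sub>R v"
        using arg_cong[OF EB[of B], of snd] by (simp add: tri_def v_def c_def)
      then have "v = c *\<^sub>R snd E + (- 1) *\<^sub>R v \<or> v = c *\<^sub>R snd E + 0 *\<^sub>R v"
        using 3(2) by (metis empty_iff insert_iff)
      then have "v = c *\<^sub>R snd E \<or> v + v = c *\<^sub>R snd E"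
        by (auto simp: eq_diff_eq)
      then have "v = c *\<^sub>R snd E \<or> v = (1 / 2 * c) *\<^sub>R snd E"
        by (metis scaleR_half_double scaleR_scaleR)
      then show ?thesis unfolding v_def by blast
    qed
    then show ?thesis using axialI[OF 3(1)] by blast
  qed
qed

section \<open>Change of sign, and unital homomorphisms at 0, -1 and the reflections\<close>

lemma tri_hom_minus: "tri_hom F \<Longrightarrow> tri_hom (\<lambda>A. - F A)"
  unfolding tri_hom_def by (simp add: tri_def)

lemma axial_minus: "axial (\<lambda>A. - F A) = axial F"
proof -
  have "axial (\<lambda>A. - F A)" if "axial F" for F
    using that unfolding axial_def by (metis scaleR_minus_left snd_uminus)
  from this[of F] this[of "\<lambda>A. - F A"] show ?thesis by auto
qed

text \<open>From 0 B 0 = 0 = B 0 B the value N = F(0) satisfies N F(B) N = N = F(B) N F(B), and N is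
  idempotent. N = 1 makes \<open>F\<close> constant; a rank-one projection N forces every vector
  part to be a multiple of that of N.\<close>

lemma unital_tri_hom_zero:
  assumes "tri_hom F" "F (1, 0) = (1, 0)" "F 0 \<noteq> 0"
  shows "axial F"
proof -
  define N where "N = F 0"
  have N1: "tri N (F B) = N" for B
    unfolding N_def using tri_homD[OF assms(1), of 0 B] by simp
  have N2: "tri (F B) N = N" for B
    unfolding N_def using tri_homD[OF assms(1), of B 0] by simp
  have NN: "tri N (1, 0) = N" using N1[of "(1, 0)"] assms(2) by simp
  show ?thesis
  proof (cases "snd N = 0")
    case True
    then have "fst N * fst N = fst N" using NN by (simp add: tri_one_right prod_eq_iff power2_eq_square)
    then have "N = (1, 0)" using True assms(3) by (auto simp: N_def[symmetric] prod_eq_iff)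
    then have "F B = (1, 0)" for B using N1[of B] by simp
    then show ?thesis using axial_pairwise[of F] by simp
  next
    case False
    have "(2 * fst N - 1) *\<^sub>R snd N = 0" using NN by (simp add: tri_one_right prod_eq_iff algebra_simps)
    then have f: "fst N = 1/2" using False by simp
    have "fst N * fst N + snd N \<bullet> snd N = fst N"
      using NN by (simp add: tri_one_right prod_eq_iff power2_eq_square)
    then have s: "snd N \<bullet> snd N = 1/4" unfolding f by simp
    have "\<exists>d. snd (F B) = d *\<^sub>R snd N" for B
    proof -
      define b v where "b = fst (F B)" and "v = snd (F B)"
      have "b/2 + v \<bullet> snd N = 1/2"
        using arg_cong[OF N1[of B], of fst] f s
        by (simp add: tri_def b_def v_def inner_commute power2_eq_square field_simps)
      moreover have "(2 * (b/2 + v \<bullet> snd N)) *\<^sub>R v + (b\<^sup>2 - v \<bullet> v) *\<^sub>R snd N = snd N"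
        using arg_cong[OF N2[of B], of snd] f by (simp add: tri_def b_def v_def)
      ultimately have "v = (1 - (b\<^sup>2 - v \<bullet> v)) *\<^sub>R snd N"
        by (simp add: algebra_simps)
      then show ?thesis unfolding v_def by blast
    qed
    then show ?thesis using axialI[OF False] by blast
  qed
qed

lemma tri_square_eq_one:
  assumes "tri X (1, 0) = (1, 0)"
  shows "X = (1, 0) \<or> X = (- 1, 0) \<or> (fst X = 0 \<and> norm (snd X) = 1)"
  using assms by (auto simp: tri_one_right prod_eq_iff power2_eq_1_iff norm_eq_1)

text \<open>Since (-1) B (-1) = B, the image D of -1 satisfies DD = 1 and D F(B) D = F(B). If D is a
  reflection, the half-turn about its axis fixes every vector part.\<close>

lemma unital_tri_hom_minus_one:
  assumes "tri_hom F" "F (1, 0) = (1, 0)"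
  shows "axial F \<or> F (- 1, 0) = (1, 0) \<or> F (- 1, 0) = (- 1, 0)"
proof -
  have D: "tri (F (- 1, 0)) (F B) = F B" for B
    using tri_homD[OF assms(1), of "(- 1, 0)" B] by simp
  have "tri (F (- 1, 0)) (1, 0) = (1, 0)" using D[of "(1, 0)"] assms(2) by simp
  from tri_square_eq_one[OF this] consider "F (- 1, 0) = (1, 0) \<or> F (- 1, 0) = (- 1, 0)"
    | "fst (F (- 1, 0)) = 0" "norm (snd (F (- 1, 0))) = 1" by blast
  then show ?thesis
  proof cases
    case 2
    define n where "n = snd (F (- 1, 0))"
    have "halfturn n (snd (F B)) = snd (F B)" for B
    proof -
      have "F (- 1, 0) = (0, n)" using 2 by (simp add: n_def prod_eq_iff)
      then have "tri (0, n) (fst (F B), snd (F B)) = F B" using D[of B] by simp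
      then have "(fst (F B), halfturn n (snd (F B))) = F B"
        using 2(2) tri_unit_left[of n] unfolding n_def by metis
      then show ?thesis by (simp add: prod_eq_iff)
    qed
    then have "snd (F B) = (n \<bullet> snd (F B)) *\<^sub>R n" for B by (rule halfturn_fixed)
    then show ?thesis using 2 unfolding axial_def n_def by blast
  qed blast
qed

lemma unital_tri_hom_unit:
  assumes "tri_hom F" "F (1, 0) = (1, 0)" "norm u = 1"
  shows "F (0, u) = (1, 0) \<or> F (0, u) = (- 1, 0) \<or> (fst (F (0, u)) = 0 \<and> norm (snd (F (0, u))) = 1)"
proof (rule tri_square_eq_one)
  have "tri (0, u) (1, 0) = (1, 0)" using assms(3) by (simp add: tri_unit_left halfturn_def)
  then show "tri (F (0, u)) (1, 0) = (1, 0)" using tri_homD[OF assms(1), of "(0, u)" "(1, 0)"] assms(2) by simp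
qed

locale unital_hom =
  fixes F :: "spin \<Rightarrow> spin"
  assumes hom: "tri_hom F" and one: "F (1, 0) = (1, 0)" and zero: "F 0 = 0"
begin

lemma F_tri: "F (tri A B) = tri (F A) (F B)"
  using hom by (rule tri_homD)

lemma F_square: "F (tri A (1, 0)) = tri (F A) (1, 0)"
  by (simp add: F_tri one)

end

text \<open>Elements with the same eigenvalues are conjugate under some \<^term>\<open>(0, r)\<close>, which here maps to a
  scalar, so the map only sees the eigenvalues.\<close>

locale scalar_hom = unital_hom +
  fixes \<epsilon> \<delta> :: real
  assumes eps: "\<And>u. norm u = 1 \<Longrightarrow> F (0, u) = (\<epsilon>, 0)" "\<epsilon>\<^sup>2 = 1"
    and delta: "F (- 1, 0) = (\<delta>, 0)" "\<delta>\<^sup>2 = 1"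
begin

lemma F_halfturn: "norm r = 1 \<Longrightarrow> F (b, halfturn r v) = F (b, v)"
  using F_tri[of "(0, r)" "(b, v)"] eps by (simp add: tri_unit_left tri_scalar_left)

lemma F_spec_indep: "norm u = 1 \<Longrightarrow> norm v = 1 \<Longrightarrow> F (spec u l m) = F (spec v l m)"
proof -
  assume u: "norm u = 1" and v: "norm v = 1"
  then obtain r where "norm r = 1" "halfturn r u = v" using halfturn_transitive[of u v] by auto
  then show ?thesis using F_halfturn[of r "(l + m) / 2" "((l - m) / 2) *\<^sub>R u"]
    by (simp add: spec_def halfturn_scaleR)
qed

lemma F_spec_swap: "norm u = 1 \<Longrightarrow> F (spec u l m) = F (spec u m l)"
  using F_spec_indep[of "- u" u m l] by (simp add: spec_minus)

lemma F_spec_tri: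
  "norm u = 1 \<Longrightarrow> F (spec u (l\<^sup>2 * l') (m\<^sup>2 * m')) = tri (F (spec u l m)) (F (spec u l' m'))"
  by (simp add: F_tri flip: tri_spec)

lemma F_spec_square: "norm u = 1 \<Longrightarrow> F (spec u (l\<^sup>2) (m\<^sup>2)) = tri (F (spec u l m)) (1, 0)"
  using F_spec_tri[of u l 1 m 1] by (simp add: spec_one one)

text \<open>The value at eigenvalues l, 1/l is X^2, and by symmetry so is the value at 1/l, l.
  Sandwiching the latter between two copies of the element behind X gives 1, hence X^4 = 1.\<close>

lemma F_spec_det_one:
  assumes u: "norm u = 1" and "l > 0"
  shows "F (spec u l (1 / l)) = (1, 0)"
proof -
  define X where "X = F (spec u (sqrt l) (1 / sqrt l))"
  have Y: "F (spec u l (1 / l)) = tri X (1, 0)"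
    using F_spec_square[OF u, of "sqrt l" "1 / sqrt l"] \<open>l > 0\<close>
    by (simp add: X_def power_divide real_sqrt_pow2)
  have "(1, 0) = F (spec u ((sqrt l)\<^sup>2 * (1 / l)) ((1 / sqrt l)\<^sup>2 * l))"
    using \<open>l > 0\<close> by (simp add: power_divide real_sqrt_pow2 spec_one one)
  also have "\<dots> = tri X (F (spec u l (1 / l)))"
    unfolding F_spec_tri[OF u] X_def using F_spec_swap[OF u] by simp
  finally have "tri (tri X (1, 0)) (1, 0) = (1, 0)"
    by (simp add: Y tri_square)
  \<comment> \<open>The scalar part a^2 + |u|^2 of X^2 excludes -1, and it vanishes only for X = 0,
    which excludes a reflection.\<close>
  from tri_square_eq_one[OF this] have "tri X (1, 0) = (1, 0)"
  proof (elim disjE)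
    assume "tri X (1, 0) = (- 1, 0)"
    then have "(fst X)\<^sup>2 + snd X \<bullet> snd X = - 1" by (simp add: tri_one_right)
    moreover have "(fst X)\<^sup>2 + snd X \<bullet> snd X \<ge> 0" by simp
    ultimately show ?thesis by linarith
  next
    assume *: "fst (tri X (1, 0)) = 0 \<and> norm (snd (tri X (1, 0))) = 1"
    then have "fst X = 0" by (auto simp: tri_one_right add_nonneg_eq_0_iff)
    with * show ?thesis by (simp add: tri_one_right)
  qed
  then show ?thesis by (simp add: Y)
qed

text \<open>Dividing by the square root of the determinant leaves eigenvalues with product 1, where
  the value is 1.\<close>

lemma F_spec_pos:
  assumes u: "norm u = 1" and "l > 0" "m > 0"
  shows "F (spec u l m) = F (sqrt (l * m), 0)"
proof -
  define r where "r = sqrt (l * m)"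
  have r: "r > 0" "r * r = l * m" using assms by (auto simp: r_def)
  have mr: "m / r = 1 / (l / r)" using r assms by (simp add: field_simps)
  have "F (spec u l m) = F (spec u ((sqrt r)\<^sup>2 * (l / r)) ((sqrt r)\<^sup>2 * (m / r)))"
    using r by simp
  also have "\<dots> = tri (F (spec u (sqrt r) (sqrt r))) (1, 0)"
    unfolding F_spec_tri[OF u] mr using F_spec_det_one[OF u, of "l / r"] r assms by simp
  also have "\<dots> = F (spec u r r)" using F_spec_square[OF u, of "sqrt r" "sqrt r"] r by simp
  finally show ?thesis by (simp add: spec_one r_def)
qed

text \<open>A = |A|^(1/2) sgn(A) |A|^(1/2), and the sign element in the middle maps to a
  scalar.\<close>

lemma F_spec_nonzero:
  assumes u: "norm u = 1" and "l \<noteq> 0" "m \<noteq> 0"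
  shows "F (spec u l m) =
    (if l * m < 0 then \<epsilon> else if l > 0 then 1 else \<delta>) *\<^sub>R F (sqrt \<bar>l * m\<bar>, 0)"
proof -
  define k where "k = (if l * m < 0 then \<epsilon> else if l > 0 then 1 else \<delta>)"
  have sp: "F (spec u 1 (- 1)) = (\<epsilon>, 0)" using eps u by (simp add: spec_def)
  have "F (spec u (sgn l) (sgn m)) = (k, 0)"
    using assms sp F_spec_swap[OF u, of 1 "- 1"] one delta
    by (auto simp: k_def sgn_if spec_one mult_less_0_iff)
  then have "F (spec u ((sqrt \<bar>l\<bar>)\<^sup>2 * sgn l) ((sqrt \<bar>m\<bar>)\<^sup>2 * sgn m)) =
      k *\<^sub>R F (spec u ((sqrt \<bar>l\<bar>)\<^sup>2) ((sqrt \<bar>m\<bar>)\<^sup>2))"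
    unfolding F_spec_tri[OF u] F_spec_square[OF u] by (simp only: tri_scalar_right[of _ k])
  moreover have "(sqrt \<bar>x\<bar>)\<^sup>2 * sgn x = x" "(sqrt \<bar>x\<bar>)\<^sup>2 = \<bar>x\<bar>" for x :: real
    by (auto simp: abs_mult_sgn)
  ultimately show ?thesis
    using F_spec_pos[OF u, of "\<bar>l\<bar>" "\<bar>m\<bar>"] assms by (simp add: abs_mult k_def)
qed

text \<open>For elements with a common axis and eigenvalue pairs S = (l, m), T = (m, l) one has STS
  = lm S = 0. Since S and T have the same image, the cube of that image vanishes.\<close>

lemma F_spec_zero:
  assumes u: "norm u = 1" and "l * m = 0"
  shows "F (spec u l m) = 0"
proof (rule tri_self_eq_0)
  have "tri (F (spec u l m)) (F (spec u m l)) = F (spec u (l * (l * m)) (m * (l * m)))"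
    unfolding F_spec_tri[OF u, symmetric] by (simp add: power2_eq_square mult_ac)
  also have "\<dots> = 0" unfolding assms(2) using zero by (simp add: spec_one zero_prod_def)
  finally show "tri (F (spec u l m)) (F (spec u l m)) = 0" using F_spec_swap[OF u, of l m] by simp
qed

lemma F_form:
  "F A = (if qdet A = 0 then 0
    else (if qdet A < 0 then \<epsilon> else if fst A > 0 then 1 else \<delta>) *\<^sub>R F (sqrt \<bar>qdet A\<bar>, 0))"
proof -
  obtain u where u: "norm u = 1" and A: "A = spec u (fst A + norm (snd A)) (fst A - norm (snd A))"
    using spec_cases by blast
  define l m where "l = fst A + norm (snd A)" and "m = fst A - norm (snd A)"
  have q: "qdet A = l * m" by (subst A) (simp add: qdet_spec u l_def m_def)
  have "l \<ge> m" "l + m = 2 * fst A" by (auto simp: l_def m_def)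
  then have "l * m > 0 \<Longrightarrow> l > 0 \<longleftrightarrow> fst A > 0" by (auto simp: zero_less_mult_iff)
  moreover have "F A = F (spec u l m)" using A by (simp add: l_def m_def)
  moreover have "l * m < 0 \<or> l * m = 0 \<or> l * m > 0" by linarith
  ultimately show ?thesis
    unfolding q using F_spec_zero[OF u, of l m] F_spec_nonzero[OF u, of l m] by auto
qed

text \<open>Comparing the vector parts of the images of s t^2 s = t s^2 t gives a linear relation
  between \<open>q\<close> and \<open>w\<close>. If its coefficients vanish,
  \<open>r *\<^sub>R q + p *\<^sub>R w\<close> is orthogonal to both vectors, hence zero, and p > 0
  still gives a multiple.\<close>

lemma F_scalar_axis:
  assumes "s > 0" "t > 0" "snd (F (s, 0)) \<noteq> 0"
  shows "\<exists>d. snd (F (t, 0)) = d *\<^sub>R snd (F (s, 0))"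
proof -
  define p q r w where "p = fst (F (s, 0))" and "q = snd (F (s, 0))"
    and "r = fst (F (t, 0))" and "w = snd (F (t, 0))"
  \<comment> \<open>F(x) is the square of F(sqrt x), which is nonzero because sqrt x (1/x) sqrt x =
    1; so its scalar part a^2 + |u|^2 is positive.\<close>
  have pos: "fst (F (x, 0)) > 0" if "x > 0" for x
  proof -
    have "F (1, 0) = tri (F (sqrt x, 0)) (F (1 / x, 0))"
      using that by (simp flip: F_tri add: tri_scalar_left)
    then have ne: "F (sqrt x, 0) \<noteq> 0" using one tri_zero_left by (metis one_neq_zero prod.inject zero_prod_def)
    have "fst (F (x, 0)) = (fst (F (sqrt x, 0)))\<^sup>2 + snd (F (sqrt x, 0)) \<bullet> snd (F (sqrt x, 0))"
      using F_square[of "(sqrt x, 0)"] that by (simp add: tri_scalar_left tri_one_right)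
    moreover have "\<dots> > 0" using ne by (auto simp: prod_eq_iff add_pos_nonneg add_nonneg_pos)
    ultimately show ?thesis by simp
  qed
  have p: "p > 0" and r: "r > 0" using pos assms by (auto simp: p_def r_def)
  have "tri (F (s, 0)) (tri (F (t, 0)) (1, 0)) = tri (F (t, 0)) (tri (F (s, 0)) (1, 0))"
    unfolding F_square[symmetric] F_tri[symmetric] by (simp add: tri_scalar_left power2_eq_square mult_ac)
  then have "(4 * (p * (w \<bullet> w) + r * (q \<bullet> w))) *\<^sub>R q = (4 * (r * (q \<bullet> q) + p * (q \<bullet> w))) *\<^sub>R w"
    unfolding tri_one_right
    by (simp add: vec_eq_iff tri_def p_def q_def r_def w_def inner_commute power2_eq_square algebra_simps)
  then have eq: "(p * (w \<bullet> w) + r * (q \<bullet> w)) *\<^sub>R q = (r * (q \<bullet> q) + p * (q \<bullet> w)) *\<^sub>R w"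
    unfolding scaleR_scaleR[symmetric] by (simp only: scaleR_cancel_left) simp
  show ?thesis
  proof (cases "r * (q \<bullet> q) + p * (q \<bullet> w) = 0")
    case False
    then have "w = ((p * (w \<bullet> w) + r * (q \<bullet> w)) / (r * (q \<bullet> q) + p * (q \<bullet> w))) *\<^sub>R q"
      using arg_cong[OF eq, of "(*\<^sub>R) (inverse (r * (q \<bullet> q) + p * (q \<bullet> w)))"]
      by (simp add: divide_inverse_commute)
    then show ?thesis unfolding w_def q_def by blast
  next
    case True
    have q: "q \<noteq> 0" using assms(3) by (simp add: q_def)
    with True eq have 2: "p * (w \<bullet> w) + r * (q \<bullet> w) = 0" by simp
    define x where "x = r *\<^sub>R q + p *\<^sub>R w"
    have "x \<bullet> q = 0" "x \<bullet> w = 0" using True 2 by (simp_all add: x_def inner_simps inner_commute)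
    then have "x \<bullet> x = 0" by (simp add: x_def inner_simps)
    then have "p *\<^sub>R w = (- r) *\<^sub>R q" by (simp add: x_def eq_neg_iff_add_eq_0 add.commute)
    then have "inverse p *\<^sub>R (p *\<^sub>R w) = inverse p *\<^sub>R ((- r) *\<^sub>R q)" by (rule arg_cong)
    then have "w = (inverse p * - r) *\<^sub>R q" using p by simp
    then show ?thesis unfolding w_def q_def by blast
  qed
qed

text \<open>By \<open>F_form\<close> every vector part is a multiple of one at a positive scalar,
  and those lie on one line by \<open>F_scalar_axis\<close>.\<close>

lemma F_axial: "axial F"
proof (rule axial_pairwise)
  fix A B assume A: "snd (F A) \<noteq> 0"
  have *: "\<exists>k. snd (F A) = k *\<^sub>R snd (F (sqrt \<bar>qdet A\<bar>, 0))" for A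
  proof (cases "qdet A = 0")
    case True
    then show ?thesis by (subst F_form) (auto intro: exI[of _ 0])
  next
    case False
    then show ?thesis by (subst F_form) auto
  qed
  obtain k where k: "snd (F A) = k *\<^sub>R snd (F (sqrt \<bar>qdet A\<bar>, 0))" using * by blast
  obtain k' where k': "snd (F B) = k' *\<^sub>R snd (F (sqrt \<bar>qdet B\<bar>, 0))" using * by blast
  have qA: "qdet A \<noteq> 0" using A F_form[of A] by auto
  show "\<exists>d. snd (F B) = d *\<^sub>R snd (F A)"
  proof (cases "qdet B = 0")
    case True
    then show ?thesis using F_form[of B] by (auto intro: exI[of _ 0])
  next
    case False
    obtain d where "snd (F (sqrt \<bar>qdet B\<bar>, 0)) = d *\<^sub>R snd (F (sqrt \<bar>qdet A\<bar>, 0))"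
      using F_scalar_axis[of "sqrt \<bar>qdet A\<bar>" "sqrt \<bar>qdet B\<bar>"] A k qA False by auto
    then have "snd (F B) = (k' * d / k) *\<^sub>R snd (F A)" using A k k' by auto
    then show ?thesis by blast
  qed
qed

end

subsection \<open>The action on reflections\<close>

text \<open>Cauchy's equation: nonnegativity yields monotonicity, additivity gives the values at
  rationals, and neighbouring fractions m/n and (m+1)/n squeeze \<open>k t\<close>.\<close>

lemma additive_unit_interval:
  fixes k :: "real \<Rightarrow> real"
  assumes add: "\<And>a b. 0 \<le> a \<Longrightarrow> 0 \<le> b \<Longrightarrow> a + b \<le> 1 \<Longrightarrow> k (a + b) = k a + k b"
    and nonneg: "\<And>a. 0 \<le> a \<Longrightarrow> a \<le> 1 \<Longrightarrow> 0 \<le> k a" and "k 1 = 1"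
    and t: "0 \<le> t" "t \<le> 1"
  shows "k t = t"
proof -
  have mono: "k a \<le> k b" if "0 \<le> a" "a \<le> b" "b \<le> 1" for a b
    using add[of a "b - a"] nonneg[of "b - a"] that by auto
  have k0: "k 0 = 0" using add[of 0 0] by simp
  have frac: "k (real m / real n) = real m / real n" if "m \<le> n" "n > 0" for m n :: nat
  proof -
    have *: "k (real j / real n) = real j * k (1 / real n)" if "j \<le> n" for j
      using that
    proof (induction j)
      case (Suc j)
      then have "k (real j / real n + 1 / real n) = k (real j / real n) + k (1 / real n)"
        using \<open>n > 0\<close> by (intro add) (auto simp: field_simps)
      then show ?case using Suc by (simp add: add_divide_distrib algebra_simps)
    qed (simp add: k0)
    from *[of n] have "real n * k (1 / real n) = 1" using \<open>n > 0\<close> \<open>k 1 = 1\<close> by simp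
    then have "k (1 / real n) = 1 / real n" using \<open>n > 0\<close> by (simp add: field_simps)
    then show ?thesis using *[OF \<open>m \<le> n\<close>] by simp
  qed
  have close: "\<bar>k t - t\<bar> \<le> 1 / real n" if n: "n > 0" for n :: nat
  proof (cases "t = 1")
    case True
    then show ?thesis using \<open>k 1 = 1\<close> by simp
  next
    case False
    define m where "m = nat \<lfloor>real n * t\<rfloor>"
    have m: "real m \<le> real n * t" "real n * t < real m + 1" using t n by (auto simp: m_def)
    have "real n * t < real n" using False t n by auto
    with m have "m < n" by (metis le_less_trans of_nat_less_iff)
    have 1: "real m / real n \<le> t" "t \<le> real (Suc m) / real n" using m n by (auto simp: field_simps)
    have "k (real m / real n) \<le> k t" "k t \<le> k (real (Suc m) / real n)"
      using 1 t \<open>m < n\<close> by (auto intro!: mono simp: divide_le_eq)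
    then have "real m / real n \<le> k t" "k t \<le> real (Suc m) / real n"
      using frac[of m n] frac[of "Suc m" n] \<open>m < n\<close> by auto
    with 1 show ?thesis by (auto simp: add_divide_distrib abs_le_iff)
  qed
  show ?thesis
  proof (rule ccontr)
    assume "k t \<noteq> t"
    then obtain n where "n > 0" "1 / real n < \<bar>k t - t\<bar>"
      using ex_inverse_of_nat_less[of "\<bar>k t - t\<bar>"] by (auto simp: inverse_eq_divide)
    with close[of n] show False by simp
  qed
qed

lemma norm_vec3: "(norm (v :: real^3))\<^sup>2 = (v $ 1)\<^sup>2 + (v $ 2)\<^sup>2 + (v $ 3)\<^sup>2"
  unfolding power2_norm_eq_inner by (simp add: inner_vec_def sum_3 power2_eq_square)

locale unit_hom = unital_hom +
  fixes f :: "real^3 \<Rightarrow> real^3"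
  assumes f: "\<And>u. norm u = 1 \<Longrightarrow> F (0, u) = (0, f u)" "\<And>u. norm u = 1 \<Longrightarrow> norm (f u) = 1"
begin

lemma f_halfturn: "norm r = 1 \<Longrightarrow> norm u = 1 \<Longrightarrow> f (halfturn r u) = halfturn (f r) (f u)"
  using F_tri[of "(0, r)" "(0, u)"] by (simp add: tri_unit_left f norm_halfturn)

text \<open>Half-turns preserve inner products, are transitive on pairs with a given one, and are
  carried by \<open>f\<close> to half-turns.\<close>

lemma f_inner_cong:
  assumes "norm u = 1" "norm v = 1" "norm u' = 1" "norm v' = 1" "u \<bullet> v = u' \<bullet> v'"
  shows "f u \<bullet> f v = f u' \<bullet> f v'"
proof -
  obtain r1 r2 r3 where r: "norm r1 = 1" "norm r2 = 1" "norm r3 = 1"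
    and uv: "halfturn r3 (halfturn r2 (halfturn r1 u)) = u'"
      "halfturn r3 (halfturn r2 (halfturn r1 v)) = v'"
    using halfturn_pair_transitive[OF assms] by blast
  show ?thesis
    unfolding uv[symmetric] using r assms(1,2) by (simp add: f_halfturn norm_halfturn inner_halfturn f)
qed

lemma f_minus: "norm u = 1 \<Longrightarrow> f (- u) = f u \<or> f (- u) = - f u"
proof -
  assume u: "norm u = 1"
  have "halfturn u (- u) = - u" using halfturn_self[OF u] halfturn_scaleR[of u "- 1" u] by simp
  then have "halfturn (f u) (f (- u)) = f (- u)" using f_halfturn[of u "- u"] u by simp
  then show ?thesis using halfturn_fixed_unit f u by simp
qed

text \<open>Evenness spreads to all vectors by \<open>f_inner_cong\<close>. Then for v orthogonal to
  u the half-turn about \<open>f u\<close> fixes \<open>f v\<close>, so \<open>f v\<close> is plus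
  or minus \<open>f u\<close>; a common orthogonal vector makes \<open>f\<close> constant. Every A
  commutes with the reflection along its own axis, so every value commutes with the single
  reflection along \<open>f u0\<close>.\<close>

lemma even_axial:
  assumes u0: "norm u0 = 1" "f (- u0) = f u0"
  shows "axial F"
proof -
  have even: "f (- u) = f u" if u: "norm u = 1" for u
  proof -
    have "f u \<bullet> f (- u) = f u0 \<bullet> f (- u0)"
      by (rule f_inner_cong) (use u u0 in \<open>simp_all add: norm_eq_1\<close>)
    also have "\<dots> = 1" using f u0 by (simp add: norm_eq_1)
    finally have "f u \<bullet> f (- u) = 1" .
    moreover have "f u \<bullet> f u = 1" using f u by (simp add: norm_eq_1)
    ultimately show ?thesis using f_minus[OF u] by fastforce
  qed
  have orth: "f v = f u \<or> f v = - f u" if "norm u = 1" "norm v = 1" "u \<bullet> v = 0" for u v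
  proof -
    have "halfturn (f u) (f v) = f v"
      using f_halfturn[of u v] even[of v] that by (simp add: halfturn_orthogonal)
    then show ?thesis using halfturn_fixed_unit f that by simp
  qed
  have const: "f u = f v" if u: "norm u = 1" and v: "norm v = 1" for u v
  proof -
    obtain w :: "real^3" where w: "norm w = 1" "w \<bullet> u = 0" "w \<bullet> v = 0"
      using ex_unit_orthogonal by blast
    have eq: "f w \<bullet> f u = f w \<bullet> f v" using f_inner_cong[of w u w v] u v w by simp
    show ?thesis
      using orth[OF w(1) u w(2)] orth[OF w(1) v w(3)] eq f(2)[OF w(1)] by (auto simp: norm_eq_1)
  qed
  have "snd (F A) = (f u0 \<bullet> snd (F A)) *\<^sub>R f u0" for A
  proof -
    obtain u where u: "norm u = 1" and A: "A = spec u (fst A + norm (snd A)) (fst A - norm (snd A))"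
      using spec_cases by blast
    have "tri (0, u) A = A"
      by (subst (1 2) A) (simp add: spec_def tri_unit_left[OF u] halfturn_scaleR halfturn_self[OF u])
    then have "tri (0, f u0) (fst (F A), snd (F A)) = (fst (F A), snd (F A))"
      using F_tri[of "(0, u)" A] f(1)[OF u] const[OF u u0(1)] by simp
    then have "halfturn (f u0) (snd (F A)) = snd (F A)"
      unfolding tri_unit_left[OF f(2)[OF u0(1)]] by (simp add: prod_eq_iff)
    then show ?thesis by (rule halfturn_fixed)
  qed
  then show ?thesis unfolding axial_def using f(2)[OF u0(1)] by blast
qed

text \<open>By oddness the half-turn about \<open>f u\<close> negates \<open>f v\<close>, which
  happens only orthogonally to the axis.\<close>

lemma odd_orthogonal:
  assumes odd: "\<And>u. norm u = 1 \<Longrightarrow> f (- u) = - f u"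
    and u: "norm u = 1" and v: "norm v = 1" and uv: "u \<bullet> v = 0"
  shows "f u \<bullet> f v = 0"
proof -
  have "halfturn (f u) (f v) = - f v"
    using f_halfturn[OF u v] odd[OF v] uv by (simp add: halfturn_orthogonal)
  then have "(2 * (f u \<bullet> f v)) *\<^sub>R f u = 0" by (simp add: halfturn_def)
  moreover have "f u \<noteq> 0" using f(2)[OF u] by auto
  ultimately show ?thesis by simp
qed

text \<open>The images of the standard basis are orthonormal and define \<open>L\<close>. Inner
  products of images depend only on the original inner product, through \<open>h\<close>; it remains
  to show that \<open>h\<close> is the identity.\<close>

lemma odd_isometry:
  assumes odd: "\<And>u. norm u = 1 \<Longrightarrow> f (- u) = - f u"
  obtains L where "orthogonal_transformation L" "\<And>u. norm u = 1 \<Longrightarrow> f u = L u"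
proof -
  define e :: "3 \<Rightarrow> real^3" where "e i = axis i 1" for i
  have e: "norm (e i) = 1" "v \<bullet> e i = v $ i" for i v
    by (auto simp: e_def inner_axis)
  define L where "L v = (\<Sum>i\<in>UNIV. (v $ i) *\<^sub>R f (e i))" for v
  have ortho: "f (e i) \<bullet> f (e j) = (if i = j then 1 else 0)" for i j
  proof (cases "i = j")
    case True
    then show ?thesis using f(2)[OF e(1)] by (simp add: norm_eq_1)
  next
    case False
    then show ?thesis using odd_orthogonal[OF odd e(1) e(1), of i j]
      by (simp add: e_def inner_axis_axis)
  qed
  have Lin: "L v \<bullet> L w = v \<bullet> w" for v w
    unfolding L_def
    by (simp add: inner_sum_left inner_sum_right ortho inner_vec_def[of v w] if_distrib mult.commute cong: if_cong)
  have "linear L"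
    unfolding L_def by (intro linear_compose_sum ballI linearI) (auto simp: algebra_simps)
  then have L: "orthogonal_transformation L" using Lin by (simp add: orthogonal_transformation_def)
  have Le: "L (e i) = f (e i)" for i
    by (simp add: L_def e_def axis_def if_distrib[of "\<lambda>c. c *\<^sub>R _"] sum.delta cong: if_cong)
  text \<open>\<open>f\<close> acts on the coordinates of a unit vector by \<open>h\<close>; then \<open>h(\<surd>t)\<^sup>2\<close> is additive, as both
    the coordinates of a unit vector and their images have squares summing to 1.\<close>
  define h where "h t = f (e 1) \<bullet> f (vector [t, sqrt (1 - t\<^sup>2), 0])" for t
  have h: "f u \<bullet> f v = h (u \<bullet> v)" if u: "norm u = 1" and v: "norm v = 1" for u v
  proof -
    define w :: "real^3" where "w = vector [u \<bullet> v, sqrt (1 - (u \<bullet> v)\<^sup>2), 0]"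
    have "\<bar>u \<bullet> v\<bar> \<le> 1" using Cauchy_Schwarz_ineq2[of u v] u v by simp
    then have "(u \<bullet> v)\<^sup>2 \<le> 1" by (simp add: abs_square_le_1)
    then have "(norm w)\<^sup>2 = 1" by (simp add: norm_vec3 w_def)
    then have "norm w = 1" by (simp add: power2_eq_1_iff) (smt (verit) norm_ge_zero)
    moreover have "u \<bullet> v = e 1 \<bullet> w" by (simp add: inner_commute[of "e 1"] e w_def)
    ultimately show ?thesis unfolding h_def w_def[symmetric]
      by (intro f_inner_cong) (auto simp: u v e)
  qed
  have fcoord: "\<exists>w. f v = L w \<and> (\<forall>i. w $ i = h (v $ i))" if v: "norm v = 1" for v :: "real^3"
  proof -
    obtain w where w: "f v = L w"
      using orthogonal_transformation_surj[OF L] by (metis surjD)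
    have "w $ i = h (v $ i)" for i
    proof -
      have "w $ i = L w \<bullet> L (e i)" by (simp add: Lin e)
      also have "\<dots> = h (v $ i)" by (simp add: w[symmetric] Le h v e)
      finally show ?thesis .
    qed
    with w show ?thesis by blast
  qed
  have hsum: "(h (v $ 1))\<^sup>2 + (h (v $ 2))\<^sup>2 + (h (v $ 3))\<^sup>2 = 1" if v: "norm v = 1" for v :: "real^3"
  proof -
    obtain w where w: "f v = L w" "\<And>i. w $ i = h (v $ i)" using fcoord[OF v] by blast
    have "norm w = 1" using f(2)[OF v] w(1) Lin[of w w] by (simp add: norm_eq_1)
    then show ?thesis using norm_vec3[of w] w(2) by simp
  qed
  define k where "k t = (h (sqrt t))\<^sup>2" for t
  have ksum: "k a + k b + k c = 1" if "0 \<le> a" "0 \<le> b" "0 \<le> c" "a + b + c = 1" for a b c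
  proof -
    define v :: "real^3" where "v = vector [sqrt a, sqrt b, sqrt c]"
    have "(norm v)\<^sup>2 = 1" using that by (simp add: norm_vec3 v_def)
    then have "norm v = 1" by (simp add: power2_eq_1_iff) (smt (verit) norm_ge_zero)
    from hsum[OF this] show ?thesis by (simp add: v_def k_def)
  qed
  have h0: "h 0 = 0" using ortho[of 1 2] h[OF e(1) e(1), of 1 2] by (simp add: e_def inner_axis_axis)
  have h1: "h 1 = 1" using ortho[of 1 1] h[OF e(1) e(1), of 1 1] by (simp add: e_def inner_axis_axis)
  have k: "k t = t" if "0 \<le> t" "t \<le> 1" for t
  proof (rule additive_unit_interval[OF _ _ _ that])
    fix a b :: real assume "0 \<le> a" "0 \<le> b" "a + b \<le> 1"
    \<comment> \<open>Compares unit vectors with squared coordinates (a, b, 1-a-b) and (a+b, 0,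
      1-a-b).\<close>
    then show "k (a + b) = k a + k b"
      using ksum[of a b "1 - a - b"] ksum[of "a + b" 0 "1 - a - b"] h0 by (simp add: k_def)
  qed (auto simp: k_def h1)
  have hid: "h s = s" if "\<bar>s\<bar> \<le> 1" for s
  proof -
    \<comment> \<open>The squares determine \<open>h s\<close> only up to sign. With s = 2 t^2 - 1
      the double-angle formula h(2 t^2 - 1) = 2 h(t)^2 - 1 removes the ambiguity; it comes from the
      half-turn about a vector at inner product t with the first axis.\<close>
    define t where "t = sqrt ((s + 1) / 2)"
    have t2: "t\<^sup>2 = (s + 1) / 2" using that by (simp add: t_def)
    then have "t\<^sup>2 \<le> 1" using that by simp
    define u :: "real^3" where "u = vector [t, sqrt (1 - t\<^sup>2), 0]"
    have "(norm u)\<^sup>2 = 1" using \<open>t\<^sup>2 \<le> 1\<close> by (simp add: norm_vec3 u_def)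
    then have u: "norm u = 1" by (simp add: power2_eq_1_iff) (smt (verit) norm_ge_zero)
    have ue: "u \<bullet> e 1 = t" by (simp add: e u_def)
    have "(h t)\<^sup>2 = t\<^sup>2" using k[of "t\<^sup>2"] \<open>t\<^sup>2 \<le> 1\<close> that by (simp add: k_def t_def)
    have "h (halfturn u (e 1) \<bullet> e 1) = halfturn (f u) (f (e 1)) \<bullet> f (e 1)"
      using h[of "halfturn u (e 1)" "e 1"] u e by (simp add: f_halfturn norm_halfturn)
    also have "\<dots> = 2 * (h t)\<^sup>2 - 1"
      using h[OF u e(1)] ue f(2)[OF e(1)]
      by (simp add: halfturn_def inner_simps power2_eq_square norm_eq_1)
    also have "halfturn u (e 1) \<bullet> e 1 = 2 * t\<^sup>2 - 1"
      using ue e(1) by (simp add: halfturn_def inner_simps power2_eq_square norm_eq_1)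
    finally show ?thesis unfolding \<open>(h t)\<^sup>2 = t\<^sup>2\<close> t2 by (simp add: add_divide_distrib)
  qed
  have "f v = L v" if v: "norm v = 1" for v
  proof -
    obtain w where w: "f v = L w" "\<And>i. w $ i = h (v $ i)" using fcoord[OF v] by blast
    have "\<bar>v $ i\<bar> \<le> 1" for i using component_le_norm_cart[of v i] v by simp
    then have "w = v" using w(2) hid by (simp add: vec_eq_iff)
    with w show ?thesis by simp
  qed
  with L that show ?thesis by blast
qed

end

subsection \<open>Homomorphisms fixing all reflections\<close>

text \<open>\<open>(fst A, - snd A)\<close> is the adjugate; at determinant 0 the value is 0, since
  \<open>1 / 0 = 0\<close>.\<close>

definition sinv :: "spin \<Rightarrow> spin" where
  "sinv A = (1 / qdet A) *\<^sub>R (fst A, - snd A)"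

text \<open>Positive determinant and negative trace single out the negative definite
  elements.\<close>

definition seta :: "spin \<Rightarrow> real" where
  "seta A = (if qdet A > 0 \<and> fst A < 0 then - 1 else 1)"

text \<open>Four maps stand for eight: complex conjugation is an isometry of the vector part and is
  carried by \<open>lift L\<close>.\<close>

definition spin_maps :: "(spin \<Rightarrow> spin) set" where
  "spin_maps = {\<lambda>A. A, sinv, \<lambda>A. seta A *\<^sub>R A, \<lambda>A. seta A *\<^sub>R sinv A}"

lemma spec_inject: "norm u = 1 \<Longrightarrow> spec u a b = spec u c d \<Longrightarrow> a = c \<and> b = d"
  by (auto simp: spec_def)

lemma sinv_spec:
  assumes "norm u = 1" "l \<noteq> 0" "m \<noteq> 0"
  shows "sinv (spec u l m) = spec u (1 / l) (1 / m)"
  unfolding sinv_def qdet_spec[OF assms(1)] using assms by (simp add: spec_def field_simps flip: scaleR_minus_left)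

lemma seta_spec:
  assumes "norm u = 1" "l \<noteq> 0" "m \<noteq> 0"
  shows "seta (spec u l m) = (if l < 0 \<and> m < 0 then - 1 else 1)"
  unfolding seta_def qdet_spec[OF assms(1)] using assms
  by (auto simp: spec_def zero_less_mult_iff)

lemma scaleR_spec: "c *\<^sub>R spec u l m = spec u (c * l) (c * m)"
  by (simp add: spec_def algebra_simps)

locale fixed_hom = unital_hom +
  fixes \<delta> :: real
  assumes fixed: "\<And>u. norm u = 1 \<Longrightarrow> F (0, u) = (0, u)"
    and delta: "F (- 1, 0) = (\<delta>, 0)" "\<delta>\<^sup>2 = 1"
begin

lemma F_halfturn:
  assumes "norm r = 1"
  shows "F (b, halfturn r v) = (fst (F (b, v)), halfturn r (snd (F (b, v))))"
  using F_tri[of "(0, r)" "(b, v)"] tri_unit_left[OF assms, of "fst (F (b, v))" "snd (F (b, v))"]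
  by (simp add: assms fixed tri_unit_left)

text \<open>The eigenvalue of the image in the direction of the axis, read off at one fixed axis;
  \<open>F_spec\<close> transfers it to all others.\<close>

definition g :: "real \<Rightarrow> real \<Rightarrow> real" where
  "g l m = fst (F (spec (axis 1 1) l m)) + axis 1 1 \<bullet> snd (F (spec (axis 1 1) l m))"

text \<open>An element commutes with the reflection along its axis, so its image keeps that axis;
  half-turns carry \<open>e\<close> to \<open>u\<close>. Reversing the axis swaps the eigenvalues,
  which makes \<open>p\<close> symmetric and \<open>q\<close> antisymmetric.\<close>

lemma F_spec:
  assumes u: "norm u = 1"
  shows "F (spec u l m) = spec u (g l m) (g m l)"
proof -
  define e :: "real^3" where "e = axis 1 1"
  have e: "norm e = 1" by (simp add: e_def)
  define p q where "p l m = fst (F (spec e l m))" and "q l m = e \<bullet> snd (F (spec e l m))" for l m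
  have sn: "snd (F (spec e l m)) = q l m *\<^sub>R e" for l m
  proof -
    have "spec e l m = ((l + m) / 2, halfturn e (((l - m) / 2) *\<^sub>R e))"
      by (simp add: spec_def halfturn_scaleR halfturn_self e)
    then have "F (spec e l m) = (p l m, halfturn e (snd (F (spec e l m))))"
      using F_halfturn[OF e, of "(l + m) / 2" "((l - m) / 2) *\<^sub>R e"]
      by (simp add: p_def spec_def)
    then have "halfturn e (snd (F (spec e l m))) = snd (F (spec e l m))" by (metis snd_conv)
    then show ?thesis unfolding q_def by (rule halfturn_fixed)
  qed
  have pq: "F (spec u l m) = (p l m, q l m *\<^sub>R u)" if u: "norm u = 1" for u l m
  proof -
    obtain r where r: "norm r = 1" "halfturn r e = u" using halfturn_transitive[of e u] e u by auto
    show ?thesis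
      using F_halfturn[OF r(1), of "(l + m) / 2" "((l - m) / 2) *\<^sub>R e"] sn[of l m] r(2)
      by (simp add: halfturn_scaleR p_def spec_def)
  qed
  have g: "g l m = p l m + q l m" for l m by (simp add: g_def p_def q_def e_def)
  have "F (spec (- e) l m) = F (spec e m l)" by (simp add: spec_minus)
  then have "p m l = p l m" "q m l *\<^sub>R e = (- q l m) *\<^sub>R e"
    using pq[of "- e" l m] pq[of e m l] e by auto
  moreover have "e \<noteq> 0" using e by auto
  ultimately have "p m l = p l m" "q m l = - q l m" using scaleR_cancel_right by blast+
  then show ?thesis using pq[OF u] by (simp add: g spec_def)
qed

lemma ex_frame: "\<exists>u w :: real^3. norm u = 1 \<and> norm w = 1 \<and> u \<bullet> w = 0"
  using ex_unit ex_unit_orthogonal by (metis inner_commute)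

lemma g_mult_square: "g (l\<^sup>2 * l') (m\<^sup>2 * m') = (g l m)\<^sup>2 * g l' m'"
proof -
  obtain u :: "real^3" where u: "norm u = 1" using ex_unit by blast
  have "F (spec u (l\<^sup>2 * l') (m\<^sup>2 * m')) = tri (F (spec u l m)) (F (spec u l' m'))"
    by (simp add: F_tri flip: tri_spec[OF u])
  then show ?thesis unfolding F_spec[OF u] tri_spec[OF u] using spec_inject[OF u] by blast
qed

lemma g_base: "g 1 1 = 1" "g 1 (- 1) = 1" "g (- 1) 1 = - 1" "g (- 1) (- 1) = \<delta>" "g 0 0 = 0"
proof -
  obtain u :: "real^3" where u: "norm u = 1" using ex_unit by blast
  show "g 1 1 = 1" "g (- 1) (- 1) = \<delta>" "g 0 0 = 0"
    using F_spec[OF u, of 1 1] F_spec[OF u, of "- 1" "- 1"] F_spec[OF u, of 0 0] one delta zero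
    by (simp_all add: spec_one zero_prod_def)
  have "spec u 1 (- 1) = (0, u)" by (simp add: spec_def)
  then have "spec u (g 1 (- 1)) (g (- 1) 1) = spec u 1 (- 1)"
    using F_spec[OF u, of 1 "- 1"] fixed[OF u] by simp
  then show "g 1 (- 1) = 1" "g (- 1) 1 = - 1" using spec_inject[OF u] by blast+
qed

lemma g_square: "g (l\<^sup>2) (m\<^sup>2) = (g l m)\<^sup>2"
  using g_mult_square[of l 1 m 1] by (simp add: g_base)

lemma g_mult: "a \<ge> 0 \<Longrightarrow> b \<ge> 0 \<Longrightarrow> g (a * x) (b * y) = g a b * g x y"
  using g_mult_square[of "sqrt a" x "sqrt b" y] g_square[of "sqrt a" "sqrt b"] by simp

lemma g_pos:
  assumes "l > 0" "m > 0"
  shows "g l m > 0"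
proof -
  have "g l m \<ge> 0" using g_square[of "sqrt l" "sqrt m"] assms by simp
  moreover have "g l m * g (1 / l) (1 / m) = 1" using g_mult[of l m "1 / l" "1 / m"] assms g_base by simp
  ultimately show ?thesis by (metis less_eq_real_def mult_zero_left zero_neq_one)
qed

text \<open>Take \<open>S = spec u s 1\<close> and \<open>R = (0, r)\<close> with \<open>r\<close> neither parallel nor orthogonal to \<open>u\<close>: by
  \<open>F_spec\<close>, \<open>S R S\<close> and its image \<open>F(S) R F(S)\<close> have the same axis.\<close>

lemma g_ratio:
  assumes "s > 0"
  shows "g s 1 = s * g 1 s \<or> g 1 s = s * g s 1"
proof -
  obtain u w :: "real^3" where u: "norm u = 1" and w: "norm w = 1" and uw: "u \<bullet> w = 0"
    using ex_frame by blast
  \<comment> \<open>The triple 3, 4, 5 makes \<open>r\<close> a unit vector with two nonzero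
    components.\<close>
  define x y where "x = (3::real) / 5" and "y = (4::real) / 5"
  define r where "r = x *\<^sub>R u + y *\<^sub>R w"
  have in1: "u \<bullet> u = 1" "w \<bullet> w = 1" "w \<bullet> u = 0" "u \<bullet> w = 0" using u w uw by (auto simp: norm_eq_1 inner_commute)
  have "norm r = 1" by (simp add: r_def norm_eq_1 inner_simps in1 x_def y_def)
  have tr: "snd (tri (spec u a b) (0, r)) = ((a\<^sup>2 + b\<^sup>2) / 2 * x) *\<^sub>R u + (a * b * y) *\<^sub>R w" for a b
    by (simp add: tri_def spec_def r_def inner_simps in1 algebra_simps power2_eq_square add_divide_distrib
        diff_divide_distrib flip: scaleR_add_left scaleR_diff_left)
  have par: "\<exists>k. snd (F A) = k *\<^sub>R snd A" if "snd A \<noteq> 0" for A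
  proof -
    obtain v where v: "norm v = 1" and A: "A = spec v (fst A + norm (snd A)) (fst A - norm (snd A))"
      using spec_cases by blast
    define l m where "l = fst A + norm (snd A)" and "m = fst A - norm (snd A)"
    have "l \<noteq> m" using that by (simp add: l_def m_def)
    have "snd (F A) = ((g l m - g m l) / (l - m)) *\<^sub>R snd A"
      using \<open>l \<noteq> m\<close> by (subst (1 2) A) (simp add: F_spec[OF v] flip: l_def m_def, simp add: spec_def)
    then show ?thesis by blast
  qed
  let ?S = "spec u s 1"
  define a b where "a = g s 1" and "b = g 1 s"
  have "w \<bullet> snd (tri ?S (0, r)) \<noteq> 0" using assms by (simp add: tr inner_simps in1 y_def)
  then have "snd (tri ?S (0, r)) \<noteq> 0" by auto
  from par[OF this] obtain k where "snd (F (tri ?S (0, r))) = k *\<^sub>R snd (tri ?S (0, r))" by blast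
  then have eq: "((a\<^sup>2 + b\<^sup>2) / 2 * x) *\<^sub>R u + (a * b * y) *\<^sub>R w =
      k *\<^sub>R (((s\<^sup>2 + 1) / 2 * x) *\<^sub>R u + (s * y) *\<^sub>R w)"
    by (simp add: F_tri F_spec[OF u] fixed[OF \<open>norm r = 1\<close>] tr a_def b_def)
  have "a\<^sup>2 + b\<^sup>2 = k * (s\<^sup>2 + 1)"
    using arg_cong[OF eq, of "inner u"] by (simp add: inner_simps in1 x_def algebra_simps)
  moreover have "a * b = k * s"
    using arg_cong[OF eq, of "inner w"] by (simp add: inner_simps in1 y_def)
  \<comment> \<open>Eliminating \<open>k\<close> gives s(a^2 + b^2) = ab(s^2 + 1), which
    factors.\<close>
  ultimately have "(a - s * b) * (s * a - b) = 0"
    by algebra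
  then show ?thesis by (auto simp: a_def b_def)
qed

text \<open>If the first alternative fails at s and the second at t, multiplicativity contradicts
  both alternatives at s t unless s = 1 or t = 1, where both hold trivially.\<close>

lemma g_ratio_uniform: "(\<forall>s>0. g s 1 = s * g 1 s) \<or> (\<forall>s>0. g 1 s = s * g s 1)"
proof (rule ccontr)
  assume "\<not> ?thesis"
  then obtain s t where s: "s > 0" "g s 1 \<noteq> s * g 1 s" and t: "t > 0" "g 1 t \<noteq> t * g t 1" by blast
  then have s': "g 1 s = s * g s 1" and t': "g t 1 = t * g 1 t" using g_ratio by blast+
  define x y where "x = g s 1" and "y = g 1 t"
  have pos: "x > 0" "y > 0" using s t g_pos by (auto simp: x_def y_def)
  have "g (s * t) 1 = x * (t * y)" "g 1 (s * t) = s * x * y"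
    using g_mult[of s 1 t 1] g_mult[of 1 s 1 t] s t s' t' by (simp_all add: x_def y_def)
  then have "t = s * t * s \<or> s = s * t * t"
    using g_ratio[of "s * t"] s t pos by auto
  then have "s = 1 \<or> t = 1" using s t by (auto simp: power2_eq_1_iff simp flip: power2_eq_square)
  then show False using s t g_base by auto
qed

lemma g_diag: "l > 0 \<Longrightarrow> m > 0 \<Longrightarrow> g l m * g m l = g (l * m) (l * m)"
  using g_mult[of l m m l] by (simp add: mult.commute)

text \<open>The product \<open>g l m * g m l\<close> depends only on l m, and the quotient is l/m or
  m/l; so \<open>g l m\<close> is the square root of product times quotient.\<close>

lemma g_pos_form:
  assumes l: "l > 0" and m: "m > 0"
  shows "(\<forall>s>0. g s 1 = s * g 1 s) \<Longrightarrow> g l m = sqrt (g (l * m) (l * m) / (l * m)) * l"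
    and "(\<forall>s>0. g 1 s = s * g s 1) \<Longrightarrow> g l m = sqrt (g (l * m) (l * m) * (l * m)) * (1 / l)"
proof -
  have 1: "g l m = g m m * g (l / m) 1" "g m l = g m m * g 1 (l / m)"
    using g_mult[of m m "l / m" 1] g_mult[of m m 1 "l / m"] l m by simp_all
  have pos: "g l m > 0" using g_pos l m by blast
  {
    assume *: "\<forall>s>0. g s 1 = s * g 1 s"
    have "l / m > 0" using l m by simp
    with * have "g (l / m) 1 = l / m * g 1 (l / m)" by blast
    then have "g l m = l / m * g m l" using 1 by simp
    then have "(g l m)\<^sup>2 = l / m * (g l m * g m l)"
      unfolding power2_eq_square by (metis mult.left_commute)
    also have "\<dots> = l / m * g (l * m) (l * m)" unfolding g_diag[OF l m] ..
    also have "\<dots> = (g (l * m) (l * m) / (l * m)) * l\<^sup>2" using l m by (simp add: power2_eq_square)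
    finally have "sqrt ((g l m)\<^sup>2) = sqrt (g (l * m) (l * m) / (l * m)) * sqrt (l\<^sup>2)"
      by (simp only: real_sqrt_mult)
    then show "g l m = sqrt (g (l * m) (l * m) / (l * m)) * l" using pos l by simp
  }
  {
    assume *: "\<forall>s>0. g 1 s = s * g s 1"
    have "l / m > 0" using l m by simp
    with * have "g 1 (l / m) = l / m * g (l / m) 1" by blast
    then have "g l m = m / l * g m l" using 1 l m by simp
    then have "(g l m)\<^sup>2 = m / l * (g l m * g m l)"
      unfolding power2_eq_square by (metis mult.left_commute)
    also have "\<dots> = m / l * g (l * m) (l * m)" unfolding g_diag[OF l m] ..
    also have "\<dots> = (g (l * m) (l * m) * (l * m)) * (1 / l)\<^sup>2" using l m by (simp add: power2_eq_square)
    finally have "sqrt ((g l m)\<^sup>2) = sqrt (g (l * m) (l * m) * (l * m)) * sqrt ((1 / l)\<^sup>2)"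
      by (simp only: real_sqrt_mult)
    then show "g l m = sqrt (g (l * m) (l * m) * (l * m)) * (1 / l)" using pos l by simp
  }
qed

text \<open>Splitting off the absolute values leaves the pairs of signs. For two negative signs the
  value is \<delta>, written as (-\<delta>) times \<open>sgn l\<close>, so \<delta> = 1 is the case
  in which \<open>seta\<close> appears.\<close>

lemma g_sign_form:
  assumes "l \<noteq> 0" "m \<noteq> 0"
  shows "g l m = (if l < 0 \<and> m < 0 then - \<delta> else 1) * sgn l * g \<bar>l\<bar> \<bar>m\<bar>"
proof -
  have "g l m = g \<bar>l\<bar> \<bar>m\<bar> * g (sgn l) (sgn m)"
    using g_mult[of "\<bar>l\<bar>" "\<bar>m\<bar>" "sgn l" "sgn m"] by (simp add: abs_mult_sgn)
  moreover have "g (sgn l) (sgn m) = (if l < 0 \<and> m < 0 then - \<delta> else 1) * sgn l"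
    using assms by (auto simp: sgn_if g_base)
  ultimately show ?thesis by (simp only: mult_ac)
qed

text \<open>\<open>g 1 0\<close> and \<open>g 0 1\<close> are 0 or 1 with product 0. If
  \<open>g 0 1 = 1\<close>, the projection P along u would map to 1 - P; but the reflection R along
  u satisfies PRP = P, whereas (1-P)R(1-P) = -(1-P).\<close>

lemma g_projection: "g 0 1 = 0"
proof -
  obtain u :: "real^3" where u: "norm u = 1" using ex_unit by blast
  have uu: "u \<bullet> u = 1" using u by (simp add: norm_eq_1)
  have "(g 1 0)\<^sup>2 = g 1 0" "(g 0 1)\<^sup>2 = g 0 1" using g_square[of 1 0] g_square[of 0 1] by simp_all
  then have v: "g 1 0 = 0 \<or> g 1 0 = 1" "g 0 1 = 0 \<or> g 0 1 = 1" by (auto simp: power2_eq_square)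
  have "g 1 0 * g 0 1 = 0" using g_mult[of 1 0 0 1] g_base by simp
  with v have "g 0 1 = 0 \<or> (g 0 1 = 1 \<and> g 1 0 = 0)" by auto
  moreover have False if *: "g 0 1 = 1" "g 1 0 = 0"
  proof -
    have "tri (spec u 1 0) (0, u) = spec u 1 0" by (simp add: tri_def spec_def uu power2_eq_square)
    then have "tri (spec u 0 1) (0, u) = spec u 0 1"
      using F_tri[of "spec u 1 0" "(0, u)"] by (simp add: F_spec[OF u] * fixed[OF u])
    then show False by (simp add: tri_def spec_def uu prod_eq_iff)
  qed
  ultimately show ?thesis by blast
qed

text \<open>PRP = x P for the projection P along u and a reflection R whose axis has component x
  along u. As P and R are fixed, \<open>g x 0 = x\<close> for |x| at most 1, and multiplicativity
  does the rest.\<close>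

lemma g_identity:
  assumes "g 1 0 = 1"
  shows "g l m = l"
proof -
  obtain u w :: "real^3" where u: "norm u = 1" and w: "norm w = 1" and uw: "u \<bullet> w = 0"
    using ex_frame by blast
  have in1: "u \<bullet> u = 1" "w \<bullet> w = 1" "w \<bullet> u = 0" "u \<bullet> w = 0" using u w uw by (auto simp: norm_eq_1 inner_commute)
  have small: "g x 0 = x" if "\<bar>x\<bar> \<le> 1" for x
  proof -
    define r where "r = x *\<^sub>R u + sqrt (1 - x\<^sup>2) *\<^sub>R w"
    have "x\<^sup>2 \<le> 1" using that by (simp add: abs_square_le_1)
    then have r: "norm r = 1" by (simp add: r_def norm_eq_1 inner_simps in1 flip: power2_eq_square)
    have "tri (spec u 1 0) (0, r) = spec u x 0"
      by (simp add: tri_def spec_def inner_simps in1 r_def power2_eq_square)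
    then have "spec u (g x 0) (g 0 x) = spec u x 0"
      using F_tri[of "spec u 1 0" "(0, r)"] assms by (simp add: F_spec[OF u] fixed[OF r] g_projection)
    then show ?thesis using spec_inject[OF u] by blast
  qed
  have pos: "g x 0 = x" if "x \<ge> 0" for x
  proof (cases "x \<le> 1")
    case True
    then show ?thesis using small that by simp
  next
    case False
    then show ?thesis using g_mult[of x 0 "1 / x" 0] assms small[of "1 / x"] by (simp add: field_simps)
  qed
  have "g l 0 = l"
    using g_mult[of "\<bar>l\<bar>" 0 "sgn l" 0] pos[of "\<bar>l\<bar>"] small[of "sgn l"]
    by (simp add: abs_mult_sgn sgn_if split: if_splits)
  then show ?thesis using g_mult[of 1 0 l m] assms by simp
qed

text \<open>The value at rank-one projections decides: \<open>g 1 0 = 1\<close> forces the identity,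
  and \<open>g 1 0 = 0\<close> annihilates all singular elements.\<close>

lemma F_form:
  "(\<forall>A. F A = A) \<or>
   (\<exists>\<beta>. \<beta> \<in> - {0} \<rightarrow> - {0} \<and> multiplicative_on (- {0}) \<beta> \<and> \<beta> 1 = 1 \<and>
     (\<exists>P\<in>spin_maps.
       \<forall>A. F A = (if qdet A = 0 then 0 else \<beta> (qdet A) *\<^sub>R P A)))"
proof -
  have "g 1 0 = 0 \<or> g 1 0 = 1" using g_square[of 1 0] by (simp add: power2_eq_square)
  then show ?thesis
  proof
    assume "g 1 0 = 1"
    then have "F A = A" for A
      using spec_cases[of A] F_spec g_identity by metis
    then show ?thesis by blast
  next
    assume g10: "g 1 0 = 0"
    have sing: "F A = 0" if "qdet A = 0" for A
    proof -
      obtain u l m where u: "norm u = 1" and A: "A = spec u l m" using spec_cases by blast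
      have lm: "l * m = 0" using that A qdet_spec[OF u] by simp
      have "g x 0 = 0" "g 0 x = 0" for x
        using g_mult[of 1 0 x 0] g_mult[of 0 1 0 x] g10 g_projection by simp_all
      then have "g l m = 0" "g m l = 0" using lm by auto
      then show ?thesis unfolding A F_spec[OF u] by (simp add: spec_def zero_prod_def)
    qed
    \<comment> \<open>Covers plain and inverse forms together: \<open>p\<close> is the identity or
      the reciprocal, and \<open>b\<close> is the positive factor depending on the product of the
      eigenvalues.\<close>
    have gen: ?thesis
      if P: "P \<in> spin_maps"
        and Pspec: "\<And>u l m. norm u = 1 \<Longrightarrow> l \<noteq> 0 \<Longrightarrow> m \<noteq> 0 \<Longrightarrow> P (spec u l m) =
          (if l < 0 \<and> m < 0 then - \<delta> else 1) *\<^sub>R spec u (p l) (p m)"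
        and b: "\<And>t. t > 0 \<Longrightarrow> b t > 0" "b 1 = 1"
        and bm: "\<And>s t. s > 0 \<Longrightarrow> t > 0 \<Longrightarrow> b (s * t) = b s * b t"
        and gb: "\<And>l m. l > 0 \<Longrightarrow> m > 0 \<Longrightarrow> g l m = b (l * m) * p l"
        and p: "\<And>l. p l = sgn l * p \<bar>l\<bar>"
      for P and p b :: "real \<Rightarrow> real"
    proof -
      \<comment> \<open>The signs of the eigenvalues are carried by \<open>P\<close>, so \<beta> is
        even.\<close>
      define \<beta> where "\<beta> t = b \<bar>t\<bar>" for t
      have "F A = \<beta> (qdet A) *\<^sub>R P A" if "qdet A \<noteq> 0" for A
      proof -
        obtain u l m where u: "norm u = 1" and A: "A = spec u l m" using spec_cases by blast
        have lm: "l \<noteq> 0" "m \<noteq> 0" using that A qdet_spec[OF u] by auto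
        define k where "k = (if l < 0 \<and> m < 0 then - \<delta> else 1)"
        have "g l m = \<beta> (l * m) * k * p l"
          unfolding g_sign_form[OF lm] using gb[of "\<bar>l\<bar>" "\<bar>m\<bar>"] lm p[of l]
          by (simp add: \<beta>_def abs_mult k_def)
        moreover have "g m l = \<beta> (l * m) * k * p m"
          unfolding g_sign_form[OF lm(2,1)] using gb[of "\<bar>m\<bar>" "\<bar>l\<bar>"] lm p[of m]
          by (simp add: \<beta>_def abs_mult k_def conj_commute mult.commute)
        ultimately show ?thesis
          unfolding A F_spec[OF u] Pspec[OF u lm] qdet_spec[OF u] by (simp add: scaleR_spec k_def mult.assoc)
      qed
      then have "\<forall>A. F A = (if qdet A = 0 then 0 else \<beta> (qdet A) *\<^sub>R P A)" using sing by simp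
      moreover have "\<beta> \<in> - {0} \<rightarrow> - {0}" using b by (auto simp: \<beta>_def) (metis less_irrefl zero_less_abs_iff)
      moreover have "multiplicative_on (- {0}) \<beta>" by (simp add: multiplicative_on_def \<beta>_def abs_mult bm)
      moreover have "\<beta> 1 = 1" using b by (simp add: \<beta>_def)
      ultimately show ?thesis using P by (intro disjI2 exI[of _ \<beta>] conjI bexI[of _ P])
    qed
    have gm: "g (s * t) (s * t) = g s s * g t t" if "s > 0" "t > 0" for s t
      using g_mult[of s s t t] that by simp
    have d: "\<delta> = 1 \<or> \<delta> = - 1" using delta(2) by (simp add: power2_eq_1_iff)
    from g_ratio_uniform show ?thesis
    proof
      assume h: "\<forall>s>0. g s 1 = s * g 1 s"
      show ?thesis
      proof (rule gen[of "if \<delta> = 1 then (\<lambda>A. seta A *\<^sub>R A) else (\<lambda>A. A)" "\<lambda>l. l"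
            "\<lambda>t. sqrt (g t t / t)"])
        show "g l m = sqrt (g (l * m) (l * m) / (l * m)) * l" if "l > 0" "m > 0" for l m
          using g_pos_form(1)[OF that h] .
        show "l = sgn l * \<bar>l\<bar>" for l :: real by (simp add: sgn_mult_abs)
      qed (use d in \<open>auto simp: spin_maps_def seta_spec g_pos g_base gm real_sqrt_mult real_sqrt_divide\<close>)
    next
      assume h: "\<forall>s>0. g 1 s = s * g s 1"
      show ?thesis
      proof (rule gen[of "if \<delta> = 1 then (\<lambda>A. seta A *\<^sub>R sinv A) else sinv" "\<lambda>l. 1 / l"
            "\<lambda>t. sqrt (g t t * t)"])
        show "g l m = sqrt (g (l * m) (l * m) * (l * m)) * (1 / l)" if "l > 0" "m > 0" for l m
          using g_pos_form(2)[OF that h] .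
        show "1 / l = sgn l * (1 / \<bar>l\<bar>)" for l :: real by (simp add: sgn_if)
      qed (use d in \<open>auto simp: spin_maps_def seta_spec sinv_spec g_pos g_base gm real_sqrt_mult\<close>)
    qed
  qed
qed

end

subsection \<open>Classification on the spin factor\<close>

definition lift :: "(real^3 \<Rightarrow> real^3) \<Rightarrow> spin \<Rightarrow> spin" where
  "lift L A = (fst A, L (snd A))"

lemma lift_tri:
  assumes "orthogonal_transformation L"
  shows "lift L (tri A B) = tri (lift L A) (lift L B)"
proof -
  have "linear L" "\<And>v w. L v \<bullet> L w = v \<bullet> w"
    using assms by (auto simp: orthogonal_transformation_def)
  then show ?thesis by (simp add: lift_def tri_def linear_add linear_cmul)
qed

text \<open>If one reflection mapped to a scalar, all would, and \<open>F_axial\<close> would apply.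
  Otherwise \<open>f\<close> is odd, hence an isometry \<open>L\<close> on the sphere, and undoing
  \<open>L\<close> leaves a homomorphism that fixes all reflections.\<close>

lemma unital_classification:
  assumes hom: "tri_hom F" and one: "F (1, 0) = (1, 0)"
  shows "axial F \<or> (\<exists>L. orthogonal_transformation L \<and>
    ((\<forall>A. F A = lift L A) \<or>
     (\<exists>\<beta>. \<beta> \<in> - {0} \<rightarrow> - {0} \<and> multiplicative_on (- {0}) \<beta> \<and> \<beta> 1 = 1 \<and>
       (\<exists>P\<in>spin_maps.
         \<forall>A. F A = (if qdet A = 0 then 0 else \<beta> (qdet A) *\<^sub>R lift L (P A))))))"
proof (cases "axial F")
  case False
  have zero: "F 0 = 0" using unital_tri_hom_zero[OF hom one] False by blast
  interpret unital_hom F by unfold_locales (fact hom one zero)+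
  obtain \<delta> where delta: "F (- 1, 0) = (\<delta>, 0)" "\<delta>\<^sup>2 = 1"
    using unital_tri_hom_minus_one[OF hom one] False by fastforce
  define f where "f u = snd (F (0, u))" for u
  have nonscalar: "fst (F (0, u)) = 0 \<and> norm (f u) = 1" if u: "norm u = 1" for u
  proof (rule ccontr)
    assume "\<not> ?thesis"
    then obtain \<epsilon> where eps: "F (0, u) = (\<epsilon>, 0)" "\<epsilon>\<^sup>2 = 1"
      using unital_tri_hom_unit[OF hom one u] unfolding f_def by fastforce
    have "F (0, v) = (\<epsilon>, 0)" if v: "norm v = 1" for v
    proof -
      obtain r where r: "norm r = 1" "halfturn r u = v" using halfturn_transitive[of u v] u v by auto
      have "F (0, v) = tri (F (0, r)) (\<epsilon>, 0)"
        using F_tri[of "(0, r)" "(0, u)"] r eps by (simp add: tri_unit_left)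
      also have "\<dots> = \<epsilon> *\<^sub>R F (tri (0, r) (1, 0))" by (simp add: tri_scalar_right[of _ \<epsilon>] F_square)
      also have "tri (0, r) (1, 0) = (1, 0)" using r by (simp add: tri_unit_left halfturn_def)
      finally show ?thesis by (simp add: one)
    qed
    then interpret scalar_hom F \<epsilon> \<delta> by unfold_locales (use eps delta in auto)
    show False using F_axial False by blast
  qed
  interpret unit_hom F f
    by unfold_locales (use nonscalar in \<open>auto simp: f_def prod_eq_iff\<close>)
  have "f (- u) = - f u" if "norm u = 1" for u
    using even_axial[OF that] f_minus[OF that] False by blast
  then obtain L where L: "orthogonal_transformation L" and fL: "\<And>u. norm u = 1 \<Longrightarrow> f u = L u"
    using odd_isometry by blast
  define K where "K = inv L"
  have K: "orthogonal_transformation K" unfolding K_def using L by (rule orthogonal_transformation_inv)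
  have KL: "K (L v) = v" and LK: "L (K v) = v" for v
    using orthogonal_transformation_bij[OF L] by (auto simp: K_def bij_is_inj bij_is_surj surj_f_inv_f)
  have K0: "K 0 = 0" using K by (simp add: orthogonal_transformation_linear linear_0)
  define G where "G A = lift K (F A)" for A
  interpret G: fixed_hom G \<delta>
  proof unfold_locales
    show "tri_hom G" unfolding tri_hom_def G_def by (simp only: F_tri lift_tri[OF K]) blast
    show "G (0, u) = (0, u)" if "norm u = 1" for u
      using that by (simp add: G_def f lift_def fL KL)
    show "G 0 = 0" by (simp add: G_def zero lift_def K0 prod_eq_iff)
  qed (use delta in \<open>simp_all add: G_def one lift_def K0\<close>)
  have FG: "F A = lift L (G A)" for A by (simp add: G_def lift_def LK)
  have lin: "lift L 0 = 0" "lift L (c *\<^sub>R A) = c *\<^sub>R lift L A" for c A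
    using orthogonal_transformation_linear[OF L]
    by (simp_all add: lift_def linear_0 linear_cmul zero_prod_def scaleR_prod_def)
  from G.F_form show ?thesis
  proof (elim disjE exE conjE bexE)
    assume "\<forall>A. G A = A"
    then have "\<forall>A. F A = lift L A" by (simp add: FG)
    with L show ?thesis by blast
  next
    fix \<beta> P
    assume *: "\<beta> \<in> - {0} \<rightarrow> - {0}" "multiplicative_on (- {0}) \<beta>" "\<beta> 1 = 1"
      "P \<in> spin_maps"
      and "\<forall>A. G A = (if qdet A = 0 then 0 else \<beta> (qdet A) *\<^sub>R P A)"
    then have "\<forall>A. F A = (if qdet A = 0 then 0 else \<beta> (qdet A) *\<^sub>R lift L (P A))"
      by (simp add: FG lin)
    with L * show ?thesis
      by (intro disjI2 exI[of _ L] conjI exI[of _ \<beta>] bexI[of _ P])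
  qed
qed simp

lemma classification:
  assumes hom: "tri_hom F"
  shows "axial F \<or> (\<exists>s\<in>{1, - 1}. \<exists>L. orthogonal_transformation L \<and>
    ((\<forall>A. F A = s *\<^sub>R lift L A) \<or>
     (\<exists>\<beta>. \<beta> \<in> - {0} \<rightarrow> - {0} \<and> multiplicative_on (- {0}) \<beta> \<and> \<beta> 1 = 1 \<and>
       (\<exists>P\<in>spin_maps.
         \<forall>A. F A = (if qdet A = 0 then 0 else (s * \<beta> (qdet A)) *\<^sub>R lift L (P A))))))"
proof -
  consider "axial F" | s :: real where "s \<in> {1, - 1}" "s *\<^sub>R F (1, 0) = (1, 0)"
    using tri_hom_one[OF hom] by force
  then show ?thesis
  proof cases
    case 2
    have s: "s * s = 1" "s = 1 \<or> s = - 1" using 2 by auto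
    have "tri_hom (\<lambda>A. s *\<^sub>R F A)" using 2(1) hom tri_hom_minus[OF hom] by auto
    note cl = unital_classification[OF this 2(2)]
    have FG: "F A = s *\<^sub>R (s *\<^sub>R F A)" for A by (simp add: s)
    have ax: "axial (\<lambda>A. s *\<^sub>R F A) = axial F" using s axial_minus[of F] by auto
    show ?thesis
      using cl unfolding ax
    proof (elim disjE exE conjE bexE)
      fix L assume "orthogonal_transformation L" "\<forall>A. s *\<^sub>R F A = lift L A"
      then show ?thesis using 2(1) FG by metis
    next
      fix L \<beta> P
      assume *: "orthogonal_transformation L" "\<beta> \<in> - {0} \<rightarrow> - {0}" "multiplicative_on (- {0}) \<beta>" "\<beta> 1 = 1"
        "P \<in> spin_maps"
        and sF: "\<forall>A. s *\<^sub>R F A = (if qdet A = 0 then 0 else \<beta> (qdet A) *\<^sub>R lift L (P A))"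
      have "\<forall>A. F A = (if qdet A = 0 then 0 else (s * \<beta> (qdet A)) *\<^sub>R lift L (P A))"
        by (subst FG, subst sF[rule_format]) simp
      with 2(1) * show ?thesis
        by (intro disjI2 bexI[of _ s] exI[of _ L] conjI exI[of _ \<beta>] bexI[of _ P])
    qed simp
  qed simp
qed

section \<open>Real-valued homomorphisms\<close>

definition npos :: "spin \<Rightarrow> nat" where
  "npos A = (if fst A + norm (snd A) > 0 then 1 else 0) + (if fst A - norm (snd A) > 0 then 1 else 0)"

text \<open>Made unital by the sign \<open>e\<close> and given zero vector part, a function that
  vanishes at 0 becomes an instance of \<open>scalar_hom\<close>, whose \<open>F_form\<close> shows
  the dependence on determinant and signs. The remaining functions are constant.\<close>

lemma real_classification:
  fixes \<phi> :: "spin \<Rightarrow> real"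
  assumes hom: "\<And>A B. \<phi> (tri A B) = (\<phi> A)\<^sup>2 * \<phi> B"
  shows "\<exists>\<psi> \<eta>. multiplicative_on {0..} \<psi> \<and> \<eta> \<in> {0, 1, 2} \<rightarrow> {- 1, 1} \<and>
    (\<forall>A. \<phi> A = \<psi> \<bar>qdet A\<bar> * \<eta> (npos A))"
proof -
  define e where "e = \<phi> (1, 0)"
  have e3: "\<phi> A = e\<^sup>2 * \<phi> A" for A using hom[of "(1, 0)" A] by (simp add: e_def)
  show ?thesis
  proof (cases "e = 0")
    case True
    then have "\<phi> A = 0" for A using e3[of A] by simp
    then show ?thesis
      by (intro exI[of _ "\<lambda>_. 0"] exI[of _ "\<lambda>_. 1"]) (simp add: multiplicative_on_def)
  next
    case False
    then have e: "e = 1 \<or> e = - 1" using e3[of "(1, 0)"] by (simp add: e_def power2_eq_1_iff)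
    define \<kappa> where "\<kappa> A = e * \<phi> A" for A
    have ee: "e * e = 1" using e by auto
    have \<phi>: "\<phi> A = e * \<kappa> A" for A using ee by (simp add: \<kappa>_def flip: mult.assoc)
    have chi: "\<kappa> (tri A B) = (\<kappa> A)\<^sup>2 * \<kappa> B" for A B
      using ee by (simp add: \<kappa>_def hom power_mult_distrib power2_eq_square mult_ac)
    have chi1: "\<kappa> (1, 0) = 1" using ee by (simp add: \<kappa>_def e_def)
    show ?thesis
    proof (cases "\<kappa> 0 = 0")
      case False
      have "\<kappa> 0 = (\<kappa> 0)\<^sup>2 * \<kappa> B" for B using chi[of 0 B] by simp
      from this[of "(1, 0)"] this have "\<kappa> B = 1" for B using False chi1 by (auto simp: power2_eq_square)
      then show ?thesis using e
        by (intro exI[of _ "\<lambda>_. 1"] exI[of _ "\<lambda>_. e"]) (auto simp: multiplicative_on_def \<phi>)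
    next
      case True
      define F where "F A = (\<kappa> A, 0 :: real^3)" for A
      have hF: "tri_hom F" unfolding tri_hom_def F_def by (simp add: tri_scalar_left chi)
      have F1: "F (1, 0) = (1, 0)" by (simp add: F_def chi1)
      have sq: "(\<kappa> A)\<^sup>2 = 1" if "tri A (1, 0) = (1, 0)" for A using chi[of A "(1, 0)"] that chi1 by simp
      obtain u0 :: "real^3" where u0: "norm u0 = 1" using ex_unit by blast
      define \<epsilon> \<delta> where "\<epsilon> = \<kappa> (0, u0)" and "\<delta> = \<kappa> (- 1, 0)"
      have unit: "tri (0, u) (1, 0) = (1, 0)" if "norm u = 1" for u
        using that by (simp add: tri_unit_left halfturn_def)
      interpret scalar_hom F \<epsilon> \<delta>
      proof unfold_locales
        show "F 0 = 0" by (simp add: F_def True prod_eq_iff)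
        show "F (0, u) = (\<epsilon>, 0)" if u: "norm u = 1" for u
        proof -
          obtain r where r: "norm r = 1" "halfturn r u0 = u" using halfturn_transitive[of u0 u] u u0 by auto
          show ?thesis using chi[of "(0, r)" "(0, u0)"] r sq[OF unit[OF r(1)]]
            by (simp add: tri_unit_left F_def \<epsilon>_def)
        qed
        show "\<epsilon>\<^sup>2 = 1" unfolding \<epsilon>_def by (rule sq[OF unit[OF u0]])
        show "\<delta>\<^sup>2 = 1" unfolding \<delta>_def by (rule sq) simp
      qed (simp_all add: hF F1, simp add: F_def \<delta>_def)
      define \<psi> where "\<psi> t = (if t = 0 then 0 else \<kappa> (sqrt t, 0))" for t
      \<comment> \<open>For nonzero determinant the counts 2, 1, 0 correspond to the three sign
        cases of \<open>F_form\<close>; for zero determinant the value is 0 because \<psi> vanishes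
        at 0.\<close>
      define \<eta> where "\<eta> n = e * (if n = 2 then 1 else if n = 1 then \<epsilon> else \<delta>)" for n :: nat
      have "\<kappa> (s * t, 0) = \<kappa> (s, 0) * \<kappa> (t, 0)" if "s > 0" "t > 0" for s t
        using chi[of "(sqrt s, 0)" "(t, 0)"] chi[of "(sqrt s, 0)" "(1, 0)"] that chi1
        by (simp add: tri_scalar_left)
      then have "multiplicative_on {0..} \<psi>"
        by (auto simp: multiplicative_on_def \<psi>_def real_sqrt_mult)
      moreover have "\<eta> \<in> {0, 1, 2} \<rightarrow> {- 1, 1}"
        using e eps(2) delta(2) by (auto simp: \<eta>_def power2_eq_1_iff)
      moreover have "\<phi> A = \<psi> \<bar>qdet A\<bar> * \<eta> (npos A)" for A
      proof -
        define l m where "l = fst A + norm (snd A)" and "m = fst A - norm (snd A)"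
        have q: "qdet A = l * m"
          by (simp add: qdet_def l_def m_def power2_eq_square algebra_simps flip: power2_norm_eq_inner)
        have *: "l \<ge> m" "l + m = 2 * fst A" by (auto simp: l_def m_def)
        have "\<kappa> A = (if qdet A = 0 then 0
          else (if qdet A < 0 then \<epsilon> else if fst A > 0 then 1 else \<delta>) * \<kappa> (sqrt \<bar>qdet A\<bar>, 0))"
          using F_form[of A] by (auto simp: F_def zero_prod_def split: if_splits)
        moreover have "qdet A > 0 \<Longrightarrow> fst A > 0 \<Longrightarrow> npos A = 2" "qdet A < 0 \<Longrightarrow> npos A = 1"
          "qdet A > 0 \<Longrightarrow> \<not> fst A > 0 \<Longrightarrow> npos A = 0"
          using * unfolding npos_def l_def[symmetric] m_def[symmetric] q
          by (auto simp: zero_less_mult_iff mult_less_0_iff)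
        ultimately show ?thesis by (auto simp: \<phi> \<psi>_def \<eta>_def not_less less_le)
      qed
      ultimately show ?thesis by blast
    qed
  qed
qed

subsection \<open>Hermitian matrices\<close>

definition herm :: "spin \<Rightarrow> complex^2^2" where
  "herm A = vector [vector [of_real (fst A + snd A $ 3), Complex (snd A $ 1) (- (snd A $ 2))],
                    vector [Complex (snd A $ 1) (snd A $ 2), of_real (fst A - snd A $ 3)]]"

definition coords :: "complex^2^2 \<Rightarrow> spin" where
  "coords M = ((Re (M $ 1 $ 1) + Re (M $ 2 $ 2)) / 2,
     vector [Re (M $ 2 $ 1), Im (M $ 2 $ 1), (Re (M $ 1 $ 1) - Re (M $ 2 $ 2)) / 2])"

lemma herm_nth [simp]:
  "herm A $ 1 $ 1 = of_real (fst A + snd A $ 3)" "herm A $ 1 $ 2 = Complex (snd A $ 1) (- (snd A $ 2))"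
  "herm A $ 2 $ 1 = Complex (snd A $ 1) (snd A $ 2)" "herm A $ 2 $ 2 = of_real (fst A - snd A $ 3)"
  by (simp_all add: herm_def)

lemma mat2_eq_iff: "(A :: 'a^2^2) = B \<longleftrightarrow>
    A $ 1 $ 1 = B $ 1 $ 1 \<and> A $ 1 $ 2 = B $ 1 $ 2 \<and> A $ 2 $ 1 = B $ 2 $ 1 \<and> A $ 2 $ 2 = B $ 2 $ 2"
  by (auto simp: vec_eq_iff forall_2)

lemma conj_matrix_nth [simp]: "conj_matrix A $ i $ j = cnj (A $ i $ j)"
  by (simp add: conj_matrix_def)

lemma conj_transpose_nth [simp]: "conj_transpose A $ i $ j = cnj (A $ j $ i)"
  by (simp add: conj_transpose_def transpose_def)

lemma herm_in_H2: "herm A \<in> H2"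
  by (simp add: H2_def mat2_eq_iff complex_eq_iff)

lemma coords_herm: "coords (herm A) = A"
  by (simp add: coords_def prod_eq_iff vec_eq_iff forall_3)

lemma herm_coords:
  assumes "M \<in> H2"
  shows "herm (coords M) = M"
proof -
  have *: "cnj (M $ j $ i) = M $ i $ j" for i j
    using assms unfolding H2_def by (metis (mono_tags) conj_transpose_nth mem_Collect_eq)
  show ?thesis using *[of 1 1] *[of 2 2] *[of 1 2]
    by (auto simp: mat2_eq_iff coords_def complex_eq_iff field_simps)
qed

lemma H2_cases:
  assumes "M \<in> H2"
  obtains A where "M = herm A"
  using herm_coords[OF assms] by metis

lemma herm_inject: "herm A = herm B \<longleftrightarrow> A = B"
  by (metis coords_herm)

lemma herm_tri: "herm A ** herm B ** herm A = herm (tri A B)"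
  by (simp add: mat2_eq_iff matrix_matrix_mult_def sum_2 tri_def inner_vec_def sum_3 complex_eq_iff
      power2_eq_square algebra_simps)

lemma herm_one: "herm (1, 0) = mat 1"
  by (simp add: mat2_eq_iff mat_def complex_eq_iff)

lemma herm_0 [simp]: "herm 0 = 0"
  by (simp add: mat2_eq_iff complex_eq_iff)

lemma herm_scaleR: "herm (c *\<^sub>R A) = c *\<^sub>R herm A"
  by (simp add: mat2_eq_iff complex_eq_iff algebra_simps)

lemma det_herm: "det (herm A) = of_real (qdet A)"
  by (simp add: det_2 qdet_def inner_vec_def sum_3 complex_eq_iff power2_eq_square algebra_simps)

lemma conj_transpose_mult: "conj_transpose (A ** B) = conj_transpose B ** conj_transpose A"
  by (simp add: vec_eq_iff matrix_matrix_mult_def mult.commute)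

lemma conj_matrix_mult: "conj_matrix (A ** B) = conj_matrix A ** conj_matrix B"
  by (simp add: vec_eq_iff matrix_matrix_mult_def)

lemma conj_transpose_herm: "conj_transpose (herm A) = herm A"
  using herm_in_H2 by (simp add: H2_def)

lemma unitary_herm:
  assumes "norm r = 1"
  shows "unitary_matrix (herm (0, r))"
proof -
  have "herm (0, r) ** herm (1, 0) ** herm (0, r) = herm (1, 0)"
    unfolding herm_tri tri_unit_left[OF assms] by (simp add: halfturn_def)
  then show ?thesis by (simp add: unitary_matrix_def conj_transpose_herm herm_one)
qed

lemma unitary_mult:
  assumes "unitary_matrix U" "unitary_matrix V"
  shows "unitary_matrix (U ** V)"
proof -
  have "U ** V ** (conj_transpose V ** conj_transpose U) = U ** (V ** conj_transpose V) ** conj_transpose U"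
    "conj_transpose V ** conj_transpose U ** (U ** V) = conj_transpose V ** (conj_transpose U ** U) ** V"
    by (simp_all only: matrix_mul_assoc)
  then show ?thesis using assms by (simp add: unitary_matrix_def conj_transpose_mult)
qed

lemma herm_halfturn:
  "norm r = 1 \<Longrightarrow> herm (a, halfturn r v) = herm (0, r) ** herm (a, v) ** conj_transpose (herm (0, r))"
  by (simp add: conj_transpose_herm herm_tri tri_unit_left)

lemma conj_matrix_herm: "conj_matrix (herm A) = herm (lift (\<lambda>v. vector [v $ 1, - (v $ 2), v $ 3]) A)"
  by (simp add: mat2_eq_iff complex_eq_iff lift_def)

lemma transpose_herm: "transpose (herm A) = conj_matrix (herm A)"
  by (simp add: mat2_eq_iff complex_eq_iff transpose_def)

lemma halfturn_involution: "norm r = 1 \<Longrightarrow> halfturn r (halfturn r v) = v"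
  by (simp add: halfturn_def norm_eq_1 inner_simps algebra_simps)

text \<open>Three half-turns, each a unitary conjugation, bring the images of the first and third
  axes back. What remains can only negate the second coordinate, and the second Pauli matrix is the
  one negated by complex conjugation.\<close>

lemma unitary_of_orthogonal:
  assumes L: "orthogonal_transformation L"
  shows "\<exists>U. unitary_matrix U \<and> ((\<forall>A. herm (lift L A) = U ** herm A ** conj_transpose U) \<or>
    (\<forall>A. herm (lift L A) = U ** conj_matrix (herm A) ** conj_transpose U))"
proof -
  define e :: "3 \<Rightarrow> real^3" where "e i = axis i 1" for i
  have e: "norm (e i) = 1" "v \<bullet> e i = v $ i" for i v by (auto simp: e_def inner_axis)
  have Lin: "L v \<bullet> L w = v \<bullet> w" for v w using L by (simp add: orthogonal_transformation_def)
  then have Ln: "norm (L v) = norm v" for v by (simp add: norm_eq_sqrt_inner)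
  obtain r1 r2 r3 where r: "norm r1 = 1" "norm r2 = 1" "norm r3 = 1"
    and *: "halfturn r3 (halfturn r2 (halfturn r1 (L (e 1)))) = e 1"
      "halfturn r3 (halfturn r2 (halfturn r1 (L (e 3)))) = e 3"
    by (rule halfturn_pair_transitive[of "L (e 1)" "L (e 3)" "e 1" "e 3"]) (auto simp: e Ln Lin)
  define K where "K v = halfturn r3 (halfturn r2 (halfturn r1 (L v)))" for v
  have Kin: "K v \<bullet> K w = v \<bullet> w" for v w by (simp add: K_def inner_halfturn r Lin)
  have K13: "K v $ 1 = v $ 1" "K v $ 3 = v $ 3" for v
    using Kin[of v "e 1"] Kin[of v "e 3"] * by (simp_all add: K_def e)
  have K2: "K (e 2) $ 1 = 0" "K (e 2) $ 3 = 0" by (simp_all add: K13 e_def axis_def)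
  define c where "c = K (e 2) $ 2"
  have cc: "c\<^sup>2 = 1"
    using K2 Kin[of "e 2" "e 2"] e(1)[of 2] by (simp add: c_def inner_vec_def sum_3 power2_eq_square norm_eq_1)
  then have pm: "c = 1 \<or> c = - 1" by (simp add: power2_eq_1_iff)
  have Kc: "K v $ 2 = v $ 2 * c" for v
  proof -
    have "K v $ 2 * c = v $ 2"
      using Kin[of v "e 2"] K2 by (simp add: c_def e inner_vec_def[of "K v"] sum_3)
    then have "K v $ 2 * c\<^sup>2 = v $ 2 * c" by (simp add: power2_eq_square)
    then show ?thesis by (simp add: cc)
  qed
  have "(\<forall>v. K v $ 2 = v $ 2) \<or> (\<forall>v. K v $ 2 = - (v $ 2))"
    using pm by (elim disjE) (simp_all add: Kc)
  then have K: "(\<forall>v. K v = v) \<or> (\<forall>v. K v = vector [v $ 1, - (v $ 2), v $ 3])"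
    by (simp add: vec_eq_iff forall_3 K13)
  define U where "U = herm (0, r1) ** herm (0, r2) ** herm (0, r3)"
  have LK: "L v = halfturn r1 (halfturn r2 (halfturn r3 (K v)))" for v
    by (simp add: K_def halfturn_involution r)
  have "herm (lift L A) = U ** herm (lift K A) ** conj_transpose U" for A
    unfolding lift_def LK by (simp add: herm_halfturn r U_def conj_transpose_mult matrix_mul_assoc)
  moreover have "unitary_matrix U" unfolding U_def by (intro unitary_mult unitary_herm r)
  ultimately show ?thesis using K by (intro exI[of _ U]) (auto simp: conj_matrix_herm lift_def)
qed

lemma matrix_inv_unique: "A ** B = mat 1 \<Longrightarrow> B ** A = mat 1 \<Longrightarrow> matrix_inv A = B"
  for A B :: "'a::semiring_1^'n^'n"
proof -
  assume *: "A ** B = mat 1" "B ** A = mat 1"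
  have "A ** matrix_inv A = mat 1 \<and> matrix_inv A ** A = mat 1"
    unfolding matrix_inv_def by (rule someI[of _ B]) (use * in simp)
  then show ?thesis using * by (metis matrix_mul_assoc matrix_mul_lid matrix_mul_rid)
qed

lemma herm_sinv:
  assumes "qdet A \<noteq> 0"
  shows "matrix_inv (herm A) = herm (sinv A)"
proof (rule matrix_inv_unique)
  have *: "herm A ** herm (fst A, - snd A) = mat (of_real (qdet A))"
    "herm (fst A, - snd A) ** herm A = mat (of_real (qdet A))"
    by (simp_all add: mat2_eq_iff mat_def matrix_matrix_mult_def sum_2 qdet_def inner_vec_def sum_3
        complex_eq_iff power2_eq_square algebra_simps)
  have sc: "M ** (c *\<^sub>R N) = c *\<^sub>R (M ** N)" "(c *\<^sub>R M) ** N = c *\<^sub>R (M ** N)" for M N :: "complex^2^2" and c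
    by (simp_all add: vec_eq_iff matrix_matrix_mult_def scaleR_sum_right)
  have one: "(1 / qdet A) *\<^sub>R (mat (of_real (qdet A)) :: complex^2^2) = mat 1"
    using assms by (simp add: mat2_eq_iff mat_def complex_eq_iff)
  show "herm A ** herm (sinv A) = mat 1" "herm (sinv A) ** herm A = mat 1"
    unfolding sinv_def herm_scaleR sc * one by simp_all
qed

section \<open>Rank, eigenvalues and definiteness in coordinates\<close>

lemma rank_herm: "rank (herm A) = 2 \<longleftrightarrow> qdet A \<noteq> 0"
proof -
  have "rank (herm A) = CARD(2) \<longleftrightarrow> invertible (herm A)"
    unfolding row_rank_def_gen invertible_left_inverse matrix_left_invertible_span_rows_gen
    by (simp add: card_cart_basis vec.dimension_def flip: vec.dim_eq_full)
  then show ?thesis by (simp add: invertible_det_nz det_herm)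
qed

lemma eigenvalues_herm:
  "eigenvalues (herm A) = {#of_real (fst A + norm (snd A)), of_real (fst A - norm (snd A))#}"
proof -
  define l m where "l = fst A + norm (snd A)" and "m = fst A - norm (snd A)"
  have "l * m = (fst A)\<^sup>2 - (norm (snd A))\<^sup>2"
    by (simp add: l_def m_def power2_eq_square algebra_simps)
  then have lm: "l * m = (fst A + snd A $ 3) * (fst A - snd A $ 3) - (snd A $ 1)\<^sup>2 - (snd A $ 2)\<^sup>2"
    unfolding norm_vec3 by (simp add: power2_eq_square algebra_simps)
  have "charpoly (herm A) = [:- of_real l, 1:] * [:- of_real m, 1:]"
    using lm by (simp add: charpoly_def det_2 mat_def complex_eq_iff l_def m_def power2_eq_square algebra_simps)
  then have "eigenvalues (herm A) = {#of_real l#} + {#of_real m#}"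
    by (simp only: eigenvalues_def) (subst proots_mult; simp)
  then show ?thesis by (simp add: l_def m_def)
qed

lemma Syl_herm: "Syl (herm A) = npos A"
  by (simp add: Syl_def eigenvalues_herm npos_def)

text \<open>The Bloch vector (Hopf map): its entries are the values of the Hermitian forms of the
  three Pauli matrices at \<open>x\<close>.\<close>

definition bloch :: "complex^2 \<Rightarrow> real^3" where
  "bloch x = vector [2 * Re (cnj (x $ 1) * x $ 2), 2 * Im (cnj (x $ 1) * x $ 2),
    (Re (x $ 1))\<^sup>2 + (Im (x $ 1))\<^sup>2 - (Re (x $ 2))\<^sup>2 - (Im (x $ 2))\<^sup>2]"

lemma norm_bloch: "norm (bloch x) = (norm x)\<^sup>2"
proof -
  have "(norm (bloch x))\<^sup>2 = ((norm x)\<^sup>2)\<^sup>2"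
    unfolding power2_norm_eq_inner[of "bloch x"] power2_norm_eq_inner[of x]
    by (simp add: inner_vec_def sum_2 sum_3 bloch_def inner_complex_def power2_eq_square algebra_simps)
  then show ?thesis by (subst (asm) power2_eq_iff_nonneg) auto
qed

lemma herm_form: "x \<bullet> (herm A *v x) = fst A * (norm x)\<^sup>2 + snd A \<bullet> bloch x"
  unfolding power2_norm_eq_inner
  by (simp add: inner_vec_def sum_2 sum_3 bloch_def matrix_vector_mult_def
      inner_complex_def power2_eq_square algebra_simps)

text \<open>Cauchy-Schwarz for \<open>snd A\<close> and \<open>bloch x\<close>; the constants are
  the two eigenvalues.\<close>

lemma herm_form_bounds:
  "(fst A - norm (snd A)) * (norm x)\<^sup>2 \<le> x \<bullet> (herm A *v x)"
  "x \<bullet> (herm A *v x) \<le> (fst A + norm (snd A)) * (norm x)\<^sup>2"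
  using Cauchy_Schwarz_ineq2[of "snd A" "bloch x"] unfolding herm_form norm_bloch
  by (auto simp: algebra_simps abs_le_iff)

lemma eta_herm:
  assumes "qdet A \<noteq> 0"
  shows "eta (herm A) = seta A"
proof -
  define l m where "l = fst A + norm (snd A)" and "m = fst A - norm (snd A)"
  have q: "qdet A = l * m"
    by (simp add: qdet_def l_def m_def power2_eq_square algebra_simps flip: power2_norm_eq_inner)
  have lm: "l \<ge> m" "l + m = 2 * fst A" by (auto simp: l_def m_def)
  note H = herm_in_H2[of A]
  note ev = eigenvalues_herm[of A, folded l_def m_def]
  consider "m > 0" | "l > 0" "m < 0" | "l < 0"
    using assms lm unfolding q by (metis linorder_neqE_linordered_idom mult_zero_left mult_zero_right)
  then show ?thesis
  proof cases
    case 1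
    have "x \<bullet> (herm A *v x) > 0" if "x \<noteq> 0" for x
      using herm_form_bounds(1)[where A = A and x = x] 1 that m_def
      by (metis less_le_trans mult_pos_pos zero_less_norm_iff zero_less_power)
    then have "positive_definite (herm A)" using H by (simp add: positive_definite_def)
    then show ?thesis using 1 lm by (simp add: eta_def seta_def q zero_less_mult_iff)
  next
    case 2
    then have "invertible_nondefinite (herm A)"
      unfolding invertible_nondefinite_def ev using H by blast
    then show ?thesis using 2 by (simp add: eta_def seta_def q zero_less_mult_iff)
  next
    case 3
    have neg: "x \<bullet> (herm A *v x) < 0" if "x \<noteq> 0" for x
      using herm_form_bounds(2)[where A = A and x = x] 3 that l_def
      by (metis le_less_trans mult_neg_pos zero_less_norm_iff zero_less_power)
    then have nd: "negative_definite (herm A)" using H by (simp add: negative_definite_def)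
    \<comment> \<open>\<open>eta\<close> tests positive definiteness and nondefiniteness first, so
      both must be refuted before the value -1 is reached.\<close>
    have "\<not> positive_definite (herm A)"
      using neg[of "axis 1 1"] unfolding positive_definite_def by (metis axis_eq_0_iff less_asym zero_neq_one)
    moreover have "\<not> invertible_nondefinite (herm A)"
    proof
      assume "invertible_nondefinite (herm A)"
      then obtain a b :: real where "a > 0" "b < 0" "{#complex_of_real l, of_real m#} = {#of_real a, of_real b#}"
        unfolding invertible_nondefinite_def ev by blast
      then have "of_real a \<in># {#complex_of_real l, of_real m#}" by simp
      with \<open>a > 0\<close> 3 lm show False by (simp split: if_splits)
    qed
    ultimately show ?thesis using 3 lm nd by (simp add: eta_def seta_def q zero_less_mult_iff)
  qed
qed

subsection \<open>The Jordan triple product homomorphisms\<close>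

lemma qdet_lift:
  assumes "orthogonal_transformation L"
  shows "qdet (lift L A) = qdet A"
  using assms by (simp add: qdet_def lift_def orthogonal_transformation_def)

lemma sinv_lift:
  assumes "orthogonal_transformation L"
  shows "sinv (lift L A) = lift L (sinv A)"
  using assms qdet_lift[OF assms, of A]
  by (simp add: sinv_def lift_def linear_cmul linear_neg orthogonal_transformation_linear)

lemma orthogonal_flip: "orthogonal_transformation (\<lambda>v :: real^3. vector [v $ 1, - (v $ 2), v $ 3] :: real^3)"
  by (auto simp: orthogonal_transformation_def inner_vec_def sum_3 vec_eq_iff forall_3 intro!: linearI)

lemma orthogonal_uminus: "orthogonal_transformation (uminus :: real^3 \<Rightarrow> real^3)"
  by (auto simp: orthogonal_transformation_def intro: linearI)

text \<open>Inversion is the isometry u to -u followed by division by the determinant. Singular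
  elements are covered because \<open>1 / 0 = 0\<close>.\<close>

lemma sinv_tri: "sinv (tri A B) = tri (sinv A) (sinv B)"
proof -
  have s: "sinv A = (1 / qdet A) *\<^sub>R lift uminus A" for A by (simp add: sinv_def lift_def)
  show ?thesis
    unfolding s qdet_tri lift_tri[OF orthogonal_uminus] tri_scaleR_left tri_scaleR_right
    by (simp add: power_divide)
qed

text \<open>ABA is positive semidefinite for positive definite B. In coordinates Cauchy-Schwarz and
  |v| at most b bound the mixed term and leave b(|a| - |u|)^2.\<close>

lemma fst_tri_nonneg:
  assumes "qdet B > 0" "fst B > 0"
  shows "fst (tri A B) \<ge> 0"
proof -
  define a b u v where "a = fst A" and "b = fst B" and "u = norm (snd A)" and "v = norm (snd B)"
  have "(norm (snd B))\<^sup>2 < b\<^sup>2" using assms(1) by (simp add: qdet_def b_def power2_norm_eq_inner)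
  then have "v \<le> b" using assms(2) by (simp add: b_def v_def power2_less_imp_less less_imp_le)
  have "\<bar>a * (snd A \<bullet> snd B)\<bar> \<le> \<bar>a\<bar> * (u * v)"
    using Cauchy_Schwarz_ineq2[of "snd A" "snd B"] by (simp add: abs_mult u_def v_def mult_left_mono)
  also have "\<dots> \<le> \<bar>a\<bar> * (u * b)" using \<open>v \<le> b\<close> by (simp add: u_def mult_left_mono)
  finally have 1: "\<bar>a * (snd A \<bullet> snd B)\<bar> \<le> \<bar>a\<bar> * (u * b)" .
  have "0 \<le> b * (\<bar>a\<bar> - u)\<^sup>2" using assms(2) by (simp add: b_def)
  also have "\<dots> = a\<^sup>2 * b - 2 * (\<bar>a\<bar> * (u * b)) + u\<^sup>2 * b"
    by (simp add: power2_eq_square algebra_simps flip: abs_mult)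
  also have "\<dots> \<le> a\<^sup>2 * b + 2 * (a * (snd A \<bullet> snd B)) + u\<^sup>2 * b" using 1 by linarith
  also have "\<dots> = fst (tri A B)" by (simp add: tri_def a_def b_def u_def power2_norm_eq_inner)
  finally show ?thesis .
qed

text \<open>Congruence by an invertible \<open>A\<close> preserves definiteness. Applying
  \<open>fst_tri_nonneg\<close> to \<open>B\<close> and \<open>- B\<close> gives the sign of the
  trace, which a positive determinant keeps away from 0.\<close>

lemma seta_tri:
  assumes "qdet A \<noteq> 0"
  shows "seta (tri A B) = seta B"
proof (cases "qdet B > 0")
  case True
  then have "qdet (tri A B) > 0" using assms by (simp add: qdet_tri)
  have b0: "fst X \<noteq> 0" if "qdet X > 0" for X
  proof -
    have "(fst X)\<^sup>2 > 0" using that inner_ge_zero[of "snd X"] unfolding qdet_def by linarith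
    then show ?thesis by simp
  qed
  have "tri A (- B) = - tri A B" using tri_scaleR_right[of A "- 1" B] by simp
  moreover have "qdet (- B) = qdet B" by (simp add: qdet_def)
  ultimately have "fst B < 0 \<Longrightarrow> fst (tri A B) \<le> 0" using fst_tri_nonneg[of "- B" A] True by simp
  then have "fst (tri A B) < 0 \<longleftrightarrow> fst B < 0"
    using fst_tri_nonneg[of B A] b0[OF True] b0[OF \<open>qdet (tri A B) > 0\<close>] True by force
  then show ?thesis using True \<open>qdet (tri A B) > 0\<close> by (simp add: seta_def)
next
  case False
  then have "\<not> qdet (tri A B) > 0" by (simp add: qdet_tri not_less mult_nonneg_nonpos)
  then show ?thesis using False by (simp add: seta_def)
qed

lemma spin_maps_tri:
  assumes "P \<in> spin_maps" "qdet A \<noteq> 0"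
  shows "P (tri A B) = tri (P A) (P B)"
proof -
  have "(seta A)\<^sup>2 = 1" by (simp add: seta_def)
  then show ?thesis
    using assms by (auto simp: spin_maps_def sinv_tri seta_tri tri_scaleR_left tri_scaleR_right)
qed

lemma conj_matrix_scaleR: "conj_matrix (c *\<^sub>R M) = c *\<^sub>R conj_matrix M"
  by (simp add: vec_eq_iff)

lemma matrix_inv_conj_herm:
  assumes "qdet A \<noteq> 0"
  shows "matrix_inv (conj_matrix (herm A)) = conj_matrix (herm (sinv A))"
  using assms by (simp add: conj_matrix_herm herm_sinv qdet_lift sinv_lift orthogonal_flip)

lemma basic_maps_herm:
  assumes "\<Psi> \<in> basic_maps"
  shows "\<exists>P\<in>spin_maps. (\<forall>A. qdet A \<noteq> 0 \<longrightarrow> \<Psi> (herm A) = herm (P A)) \<or>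
    (\<forall>A. qdet A \<noteq> 0 \<longrightarrow> \<Psi> (herm A) = conj_matrix (herm (P A)))"
  using assms unfolding basic_maps_def spin_maps_def
  by (elim insertE emptyE; simp add: eta_herm herm_sinv matrix_inv_conj_herm herm_scaleR
      conj_matrix_scaleR del: split_paired_All)

lemma spin_maps_herm:
  assumes "P \<in> spin_maps"
  shows "\<exists>\<Psi>\<in>basic_maps. \<forall>A. qdet A \<noteq> 0 \<longrightarrow> \<Psi> (herm A) = herm (P A)"
    and "\<exists>\<Psi>\<in>basic_maps. \<forall>A. qdet A \<noteq> 0 \<longrightarrow> \<Psi> (herm A) = conj_matrix (herm (P A))"
  using assms unfolding basic_maps_def spin_maps_def
  by (elim insertE emptyE; simp add: eta_herm herm_sinv matrix_inv_conj_herm herm_scaleR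
      conj_matrix_scaleR del: split_paired_All)+

lemma jtp_hom_herm: "jtp_hom F \<longleftrightarrow> (\<forall>A B. F (herm (tri A B)) = F (herm A) ** F (herm B) ** F (herm A))"
  unfolding jtp_hom_def by (metis H2_cases herm_in_H2 herm_tri)

lemma jtp_hom_real_herm:
  "jtp_hom_real f \<longleftrightarrow> (\<forall>A B. f (herm (tri A B)) = f (herm A) * f (herm B) * f (herm A))"
  unfolding jtp_hom_real_def by (metis H2_cases herm_in_H2 herm_tri)

lemma real_jtp_hom:
  fixes \<phi> :: "spin \<Rightarrow> real"
  assumes hom: "\<And>A B. \<phi> (tri A B) = (\<phi> A)\<^sup>2 * \<phi> B"
  shows "jtp_hom_real (\<lambda>M. \<phi> (coords M))" "det_Syl_form (\<lambda>M. \<phi> (coords M))"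
proof -
  show "jtp_hom_real (\<lambda>M. \<phi> (coords M))"
    by (simp add: jtp_hom_real_herm coords_herm hom power2_eq_square)
  obtain \<psi> \<eta> where *: "multiplicative_on {0..} \<psi>" "\<eta> \<in> {0, 1, 2} \<rightarrow> {- 1, 1}"
    "\<And>A. \<phi> A = \<psi> \<bar>qdet A\<bar> * \<eta> (npos A)"
    using real_classification[of \<phi>, OF hom] by blast
  have "complex_of_real (\<phi> (coords M)) = of_real (\<psi> (norm (det M))) * of_real (\<eta> (Syl M))"
    if M: "M \<in> H2" for M
  proof -
    obtain A where "M = herm A" using H2_cases[OF M] by blast
    then show ?thesis by (simp add: coords_herm det_herm Syl_herm *(3))
  qed
  moreover have "multiplicative_on {0..} (\<lambda>t. complex_of_real (\<psi> t))"
    using *(1) by (simp add: multiplicative_on_def)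
  ultimately show "det_Syl_form (\<lambda>M. \<phi> (coords M))"
    unfolding det_Syl_form_def using *(2) by (intro exI[of _ "\<lambda>t. complex_of_real (\<psi> t)"] exI[of _ \<eta>]) simp
qed

lemma unitary_conj_mult:
  assumes "unitary_matrix U"
  shows "(U ** X ** conj_transpose U) ** (U ** Y ** conj_transpose U) = U ** (X ** Y) ** conj_transpose U"
proof -
  have "(U ** X ** conj_transpose U) ** (U ** Y ** conj_transpose U) =
      U ** X ** (conj_transpose U ** U) ** Y ** conj_transpose U"
    by (simp only: matrix_mul_assoc)
  also have "\<dots> = U ** (X ** Y) ** conj_transpose U"
    using assms by (simp add: unitary_matrix_def matrix_mul_assoc)
  finally show ?thesis .
qed

lemma matrix_mul_scaleR [simp]:
  fixes M :: "complex^'n^'m" and N :: "complex^'k^'n"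
  shows "M ** (c *\<^sub>R N) = c *\<^sub>R (M ** N)" "(c *\<^sub>R M) ** N = c *\<^sub>R (M ** N)"
  by (simp_all add: vec_eq_iff matrix_matrix_mult_def scaleR_sum_right)

lemma diag2_mult: "diag2 a b ** diag2 c d = diag2 (a * c) (b * d)"
  by (simp add: diag2_def mat2_eq_iff matrix_matrix_mult_def sum_2)

text \<open>Unitary conjugation is multiplicative and s^3 = s. In form (iv) ABA is singular exactly
  when A or B is, and otherwise \<open>spin_maps_tri\<close> applies.\<close>

lemma jtp_hom_forms:
  assumes U: "unitary_matrix U"
  shows "jtp_hom_real \<phi>\<^sub>1 \<Longrightarrow> jtp_hom_real \<phi>\<^sub>2 \<Longrightarrow> \<forall>A\<in>H2. \<Phi> A =
      U ** diag2 (complex_of_real (\<phi>\<^sub>1 A)) (complex_of_real (\<phi>\<^sub>2 A)) ** conj_transpose U \<Longrightarrow> jtp_hom \<Phi>"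
    and "s \<in> {1, - 1} \<Longrightarrow> \<forall>A\<in>H2. \<Phi> A = s *\<^sub>R (U ** A ** conj_transpose U) \<Longrightarrow> jtp_hom \<Phi>"
    and "s \<in> {1, - 1} \<Longrightarrow> \<forall>A\<in>H2. \<Phi> A = s *\<^sub>R (U ** conj_matrix A ** conj_transpose U) \<Longrightarrow> jtp_hom \<Phi>"
    and "s \<in> {1, - 1} \<Longrightarrow> \<Psi> \<in> basic_maps \<Longrightarrow> \<beta> \<in> - {0} \<rightarrow> - {0} \<Longrightarrow> multiplicative_on (- {0}) \<beta> \<Longrightarrow>
      \<forall>A\<in>H2. \<Phi> A = (if rank A = 2 then (s * \<beta> (Re (det A))) *\<^sub>R (U ** \<Psi> A ** conj_transpose U) else 0)
      \<Longrightarrow> jtp_hom \<Phi>"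
proof -
  note conj = unitary_conj_mult[OF U] herm_in_H2
  {
    assume "jtp_hom_real \<phi>\<^sub>1" "jtp_hom_real \<phi>\<^sub>2" "\<forall>A\<in>H2. \<Phi> A =
      U ** diag2 (complex_of_real (\<phi>\<^sub>1 A)) (complex_of_real (\<phi>\<^sub>2 A)) ** conj_transpose U"
    then show "jtp_hom \<Phi>" by (simp add: jtp_hom_herm jtp_hom_real_herm conj diag2_mult)
  next
    assume "s \<in> {1, - 1}" "\<forall>A\<in>H2. \<Phi> A = s *\<^sub>R (U ** A ** conj_transpose U)"
    then show "jtp_hom \<Phi>" by (auto simp: jtp_hom_herm conj herm_tri)
  next
    assume "s \<in> {1, - 1}" "\<forall>A\<in>H2. \<Phi> A = s *\<^sub>R (U ** conj_matrix A ** conj_transpose U)"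
    then show "jtp_hom \<Phi>" by (auto simp: jtp_hom_herm conj herm_tri simp flip: conj_matrix_mult)
  next
    assume s: "s \<in> {1, - 1}" and \<Psi>: "\<Psi> \<in> basic_maps" and \<beta>: "\<beta> \<in> - {0} \<rightarrow> - {0}" "multiplicative_on (- {0}) \<beta>"
      and \<Phi>: "\<forall>A\<in>H2. \<Phi> A =
        (if rank A = 2 then (s * \<beta> (Re (det A))) *\<^sub>R (U ** \<Psi> A ** conj_transpose U) else 0)"
    have *: "\<Psi> (herm (tri A B)) = \<Psi> (herm A) ** \<Psi> (herm B) ** \<Psi> (herm A)"
      if "qdet A \<noteq> 0" "qdet B \<noteq> 0" for A B
    proof -
      have "qdet (tri A B) \<noteq> 0" using that by (simp add: qdet_tri)
      then show ?thesis
        using basic_maps_herm[OF \<Psi>] that spin_maps_tri[OF _ that(1), of _ B]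
        by (auto simp: herm_tri simp del: split_paired_All simp flip: conj_matrix_mult)
    qed
    have \<beta>m: "\<beta> (x * y) = \<beta> x * \<beta> y" if "x \<noteq> 0" "y \<noteq> 0" for x y
      using \<beta>(2) that by (simp add: multiplicative_on_def)
    have \<Phi>': "\<Phi> (herm A) = (if qdet A = 0 then 0 else (s * \<beta> (qdet A)) *\<^sub>R (U ** \<Psi> (herm A) ** conj_transpose U))" for A
      using \<Phi> herm_in_H2[of A] by (simp add: rank_herm det_herm)
    show "jtp_hom \<Phi>"
      unfolding jtp_hom_herm
    proof (intro allI)
      fix A B
      show "\<Phi> (herm (tri A B)) = \<Phi> (herm A) ** \<Phi> (herm B) ** \<Phi> (herm A)"
      proof (cases "qdet A = 0 \<or> qdet B = 0")
        case True
        then show ?thesis by (auto simp: \<Phi>' qdet_tri)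
      next
        case False
        then have nz: "qdet A \<noteq> 0" "qdet B \<noteq> 0" "qdet (tri A B) \<noteq> 0" by (auto simp: qdet_tri)
        then have "\<beta> (qdet (tri A B)) = \<beta> (qdet A) * \<beta> (qdet B) * \<beta> (qdet A)"
          by (simp add: qdet_tri power2_eq_square \<beta>m)
        moreover have "s * s = 1" using s by auto
        ultimately show ?thesis using nz by (simp add: \<Phi>' conj * mult_ac)
      qed
    qed
  }
qed

text \<open>In coordinates \<open>classification\<close> applies: the axial case gives form (i), the
  pure isometries give (ii) and (iii) by \<open>unitary_of_orthogonal\<close>, and the rest is
  (iv).\<close>

lemma jtp_hom_classification:
  assumes maps: "\<Phi> \<in> H2 \<rightarrow> H2" and hom: "jtp_hom \<Phi>"
  shows "\<exists>U :: complex^2^2. unitary_matrix U \<and>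
      ((\<exists>\<phi>\<^sub>1 \<phi>\<^sub>2 :: complex^2^2 \<Rightarrow> real.
          jtp_hom_real \<phi>\<^sub>1 \<and> det_Syl_form \<phi>\<^sub>1 \<and> jtp_hom_real \<phi>\<^sub>2 \<and> det_Syl_form \<phi>\<^sub>2 \<and>
          (\<forall>A\<in>H2. \<Phi> A =
             U ** diag2 (complex_of_real (\<phi>\<^sub>1 A)) (complex_of_real (\<phi>\<^sub>2 A)) ** conj_transpose U))
       \<or> (\<exists>s\<in>{1, - 1 :: real}. \<forall>A\<in>H2. \<Phi> A = s *\<^sub>R (U ** A ** conj_transpose U))
       \<or> (\<exists>s\<in>{1, - 1 :: real}. \<forall>A\<in>H2.
            \<Phi> A = s *\<^sub>R (U ** conj_matrix A ** conj_transpose U) \<and>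
            \<Phi> A = s *\<^sub>R (U ** transpose A ** conj_transpose U))
       \<or> (\<exists>s\<in>{1, - 1 :: real}. \<exists>\<beta> :: real \<Rightarrow> real. \<exists>\<Psi>\<in>basic_maps.
            \<beta> \<in> - {0} \<rightarrow> - {0} \<and> multiplicative_on (- {0}) \<beta> \<and> \<beta> 1 = 1 \<and>
            (\<forall>A\<in>H2. \<Phi> A =
               (if rank A = 2
                then (s * \<beta> (Re (det A))) *\<^sub>R (U ** \<Psi> A ** conj_transpose U)
                else 0))))"
proof -
  define F where "F A = coords (\<Phi> (herm A))" for A
  have \<Phi>: "\<Phi> (herm A) = herm (F A)" for A
    using maps herm_in_H2[of A] by (simp add: F_def herm_coords Pi_iff)
  have "tri_hom F"
    unfolding tri_hom_def using hom by (simp add: jtp_hom_herm \<Phi> herm_tri herm_inject)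
  from classification[OF this] consider n where "norm n = 1" "\<And>A. \<exists>d. snd (F A) = d *\<^sub>R n"
    | (iso) s L where "s \<in> {1, - 1}" "orthogonal_transformation L" "\<And>A. F A = s *\<^sub>R lift L A"
    | (inv) s L \<beta> P where "s \<in> {1, - 1}" "orthogonal_transformation L" "P \<in> spin_maps"
      "\<beta> \<in> - {0} \<rightarrow> - {0}" "multiplicative_on (- {0}) \<beta>" "\<beta> 1 = 1"
      "\<And>A. F A = (if qdet A = 0 then 0 else (s * \<beta> (qdet A)) *\<^sub>R lift L (P A))"
    unfolding axial_def by blast
  then show ?thesis
  proof cases
    case 1
    define d where "d A = n \<bullet> snd (F A)" for A
    have "snd (F A) = d A *\<^sub>R n" for A
      using 1(2)[of A] 1(1) by (auto simp: d_def norm_eq_1)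
    then have F: "F A = spec n (fst (F A) + d A) (fst (F A) - d A)" for A
      by (simp add: spec_def prod_eq_iff)
    define \<phi>\<^sub>1 \<phi>\<^sub>2 where "\<phi>\<^sub>1 A = fst (F A) + d A" and "\<phi>\<^sub>2 A = fst (F A) - d A" for A
    have F: "F A = spec n (\<phi>\<^sub>1 A) (\<phi>\<^sub>2 A)" for A using F[of A] by (simp only: \<phi>\<^sub>1_def \<phi>\<^sub>2_def)
    have "\<phi>\<^sub>1 (tri A B) = (\<phi>\<^sub>1 A)\<^sup>2 * \<phi>\<^sub>1 B \<and> \<phi>\<^sub>2 (tri A B) = (\<phi>\<^sub>2 A)\<^sup>2 * \<phi>\<^sub>2 B" for A B
    proof (rule spec_inject[OF 1(1)])
      show "spec n (\<phi>\<^sub>1 (tri A B)) (\<phi>\<^sub>2 (tri A B)) = spec n ((\<phi>\<^sub>1 A)\<^sup>2 * \<phi>\<^sub>1 B) ((\<phi>\<^sub>2 A)\<^sup>2 * \<phi>\<^sub>2 B)"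
        using tri_homD[OF \<open>tri_hom F\<close>, of A B] unfolding F tri_spec[OF 1(1)] .
    qed
    then have hom: "\<phi>\<^sub>1 (tri A B) = (\<phi>\<^sub>1 A)\<^sup>2 * \<phi>\<^sub>1 B" "\<phi>\<^sub>2 (tri A B) = (\<phi>\<^sub>2 A)\<^sup>2 * \<phi>\<^sub>2 B" for A B
      by blast+
    \<comment> \<open>Elements along the third axis are the diagonal matrices, so moving that axis
      to \<open>n\<close> diagonalises all values at once.\<close>
    obtain r where r: "norm r = 1" "halfturn r (axis 3 1) = n"
      using halfturn_transitive[of "axis 3 1" n] 1(1) by auto
    define U where "U = herm (0, r)"
    have "herm (spec n l m) = U ** diag2 (of_real l) (of_real m) ** conj_transpose U" for l m
    proof -
      have "herm (spec n l m) = U ** herm (spec (axis 3 1) l m) ** conj_transpose U"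
        unfolding spec_def U_def r(2)[symmetric] halfturn_scaleR[symmetric] by (rule herm_halfturn[OF r(1)])
      also have "herm (spec (axis 3 1) l m) = diag2 (of_real l) (of_real m)"
        by (simp add: mat2_eq_iff diag2_def spec_def axis_def complex_eq_iff field_simps)
      finally show ?thesis .
    qed
    then have "\<Phi> (herm A) = U ** diag2 (of_real (\<phi>\<^sub>1 A)) (of_real (\<phi>\<^sub>2 A)) ** conj_transpose U" for A
      by (simp add: \<Phi> F)
    then have "\<forall>M\<in>H2. \<Phi> M = U ** diag2 (of_real (\<phi>\<^sub>1 (coords M))) (of_real (\<phi>\<^sub>2 (coords M))) ** conj_transpose U"
      by (metis H2_cases coords_herm)
    with real_jtp_hom[of \<phi>\<^sub>1, OF hom(1)] real_jtp_hom[of \<phi>\<^sub>2, OF hom(2)] unitary_herm[OF r(1)]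
    show ?thesis unfolding U_def by blast
  next
    case iso
    from unitary_of_orthogonal[OF iso(2)] obtain U where U: "unitary_matrix U"
      "(\<forall>A. herm (lift L A) = U ** herm A ** conj_transpose U) \<or>
       (\<forall>A. herm (lift L A) = U ** conj_matrix (herm A) ** conj_transpose U)" by blast
    from U(2) show ?thesis
    proof
      assume "\<forall>A. herm (lift L A) = U ** herm A ** conj_transpose U"
      then have "\<Phi> (herm A) = s *\<^sub>R (U ** herm A ** conj_transpose U)" for A
        by (simp add: \<Phi> iso(3) herm_scaleR del: split_paired_All)
      then have "\<forall>M\<in>H2. \<Phi> M = s *\<^sub>R (U ** M ** conj_transpose U)" by (metis H2_cases)
      with U(1) iso(1) show ?thesis by blast
    next
      assume "\<forall>A. herm (lift L A) = U ** conj_matrix (herm A) ** conj_transpose U"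
      then have "\<Phi> (herm A) = s *\<^sub>R (U ** conj_matrix (herm A) ** conj_transpose U)" for A
        by (simp add: \<Phi> iso(3) herm_scaleR del: split_paired_All)
      then have "\<forall>M\<in>H2. \<Phi> M = s *\<^sub>R (U ** conj_matrix M ** conj_transpose U) \<and>
          \<Phi> M = s *\<^sub>R (U ** transpose M ** conj_transpose U)"
        by (metis H2_cases transpose_herm)
      with U(1) iso(1) show ?thesis by blast
    qed
  next
    case inv
    from unitary_of_orthogonal[OF inv(2)] obtain U where U: "unitary_matrix U"
      "(\<forall>A. herm (lift L A) = U ** herm A ** conj_transpose U) \<or>
       (\<forall>A. herm (lift L A) = U ** conj_matrix (herm A) ** conj_transpose U)" by blast
    \<comment> \<open>A complex conjugation coming from \<open>L\<close> is absorbed into the choice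
      among the eight maps.\<close>
    obtain \<Psi> where \<Psi>: "\<Psi> \<in> basic_maps"
      "\<And>A. qdet A \<noteq> 0 \<Longrightarrow> herm (lift L (P A)) = U ** \<Psi> (herm A) ** conj_transpose U"
      using U(2) spin_maps_herm[OF inv(3)] by metis
    have "\<Phi> (herm A) = (if rank (herm A) = 2
        then (s * \<beta> (Re (det (herm A)))) *\<^sub>R (U ** \<Psi> (herm A) ** conj_transpose U) else 0)" for A
      by (simp add: \<Phi> inv(7) herm_scaleR \<Psi>(2) rank_herm det_herm)
    then have "\<forall>M\<in>H2. \<Phi> M = (if rank M = 2
        then (s * \<beta> (Re (det M))) *\<^sub>R (U ** \<Psi> M ** conj_transpose U) else 0)"
      by (metis H2_cases)
    with U(1) inv(1,4-6) \<Psi>(1) show ?thesis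
      by (intro exI[of _ U] conjI disjI2 bexI[of _ s] exI[of _ \<beta>] bexI[of _ \<Psi>])
  qed
qed

theorem theorem2p1:
  fixes \<Phi> :: "complex^2^2 \<Rightarrow> complex^2^2"
  assumes "\<Phi> \<in> H2 \<rightarrow> H2"
  shows "jtp_hom \<Phi> \<longleftrightarrow>
    (\<exists>U :: complex^2^2. unitary_matrix U \<and>
      ((\<exists>\<phi>\<^sub>1 \<phi>\<^sub>2 :: complex^2^2 \<Rightarrow> real.
          jtp_hom_real \<phi>\<^sub>1 \<and> det_Syl_form \<phi>\<^sub>1 \<and> jtp_hom_real \<phi>\<^sub>2 \<and> det_Syl_form \<phi>\<^sub>2 \<and>
          (\<forall>A\<in>H2. \<Phi> A =
             U ** diag2 (complex_of_real (\<phi>\<^sub>1 A)) (complex_of_real (\<phi>\<^sub>2 A)) ** conj_transpose U))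
       \<or> (\<exists>s\<in>{1, - 1 :: real}. \<forall>A\<in>H2. \<Phi> A = s *\<^sub>R (U ** A ** conj_transpose U))
       \<or> (\<exists>s\<in>{1, - 1 :: real}. \<forall>A\<in>H2.
            \<Phi> A = s *\<^sub>R (U ** conj_matrix A ** conj_transpose U) \<and>
            \<Phi> A = s *\<^sub>R (U ** transpose A ** conj_transpose U))
       \<or> (\<exists>s\<in>{1, - 1 :: real}. \<exists>\<beta> :: real \<Rightarrow> real. \<exists>\<Psi>\<in>basic_maps.
            \<beta> \<in> - {0} \<rightarrow> - {0} \<and> multiplicative_on (- {0}) \<beta> \<and> \<beta> 1 = 1 \<and>
            (\<forall>A\<in>H2. \<Phi> A =
               (if rank A = 2
                then (s * \<beta> (Re (det A))) *\<^sub>R (U ** \<Psi> A ** conj_transpose U)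
                else 0)))))" (is "_ \<longleftrightarrow> ?forms")
proof
  assume "jtp_hom \<Phi>"
  with assms show ?forms by (rule jtp_hom_classification)
next
  assume ?forms
  then show "jtp_hom \<Phi>"
    by (elim exE conjE disjE bexE) (blast intro: jtp_hom_forms)+
qed

end
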